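(* Let $\Lambda$ be a finite, strongly connected $k$-graph and let $\delta\in(0,1)$. Suppose that $w_\delta(\lambda)=\operatorname{diam}[\lambda]$ for all $\lambda\in F\mathcal{B}_\Lambda$, where the diameter is taken with respect to $d_\delta$. Let $\zeta_\delta(s)=\sum_{\lambda\in F\mathcal{B}_\Lambda}w_\delta(\lambda)^s$. Then, for real $s$, $$\zeta_\delta(s)<\infty\quad\text{if and only if}\quad s>\delta.$$
   Context: $\mathbb{N}=\{0,1,2,\dots\}$. A $k$-graph is a countable small category $\Lambda$ with a functor $d:\Lambda\to\mathbb{N}^k$ ($\mathbb{N}^k$ viewed as a one-object category) satisfying the factorization property: if $d(\lambda)=m+n$, there are unique $\mu,\nu\in\Lambda$ with $d(\mu)=m$, $d(\nu)=n$ and $\lambda=\mu\nu$. $r,s$ denote range and source of morphisms; $\Lambda^n=d^{-1}(n)$; $\Lambda^0$ is the set of vertices. $\Lambda$ is finite if every $\Lambda^n$ is finite, and strongly connected if for all $v,w\in\Lambda^0$ there is a morphism with range $v$ and source $w$. $A_i(v,w)=\#\{\lambda\in\Lambda^{e_i}: r(\lambda)=v,s(\lambda)=w\}$, and $\rho_i$ is the spectral radius of $A_i$. The Perron–Frobenius eigenvector $x^\Lambda\in(0,\infty)^{\Lambda^0}$ is the unique positive vector with $\sum_v x^\Lambda_v=1$ and $A_ix^\Lambda=\rho_ix^\Lambda$ for all $i$. The stationary $k$-Bratteli diagram $\mathcal{B}_\Lambda$ has vertex set $\bigsqcup_{n\ge0}\mathcal{V}_n$, each $\mathcal{V}_n$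 a copy of $\Lambda^0$, and edge set $\bigsqcup_{n\ge1}\mathcal{E}_n$; edges in $\mathcal{E}_n$ have source in $\mathcal{V}_n$ and range in $\mathcal{V}_{n-1}$, and if $n\equiv i\pmod k$ with $1\le i\le k$, there are $A_i(p,q)$ edges with range $p\in\mathcal{V}_{n-1}$ and source $q\in\mathcal{V}_n$. $X_{\mathcal{B}_\Lambda}$ is the set of infinite paths $(x_n)_{n\ge1}$, $x_n\in\mathcal{E}_n$, $s(x_n)=r(x_{n+1})$; $F\mathcal{B}_\Lambda$ is the set of finite paths with range in $\mathcal{V}_0$ (length-$0$ paths being vertices of $\mathcal{V}_0$); $|\eta|$ is length; $[\lambda]$ is the set of infinite paths with initial segment $\lambda$. For $|\eta|=qk+t$ with $q,t\in\mathbb{N}$, $0\le t\le k-1$, $$w_\delta(\eta)=\left(\rho_1^{q+1}\cdots\rho_t^{q+1}\rho_{t+1}^q\cdots\rho_k^q\right)^{-1/\delta}x^\Lambda_{s(\eta)}.$$ The associated metric $d_\delta$ on $X_{\mathcal{B}_\Lambda}$ is: $d_\delta(x,x)=0$; $d_\delta(x,y)=1$ if $x,y$ have no common initial segment in $F\mathcal{B}_\Lambda$ (different ranges); otherwise $d_\delta(x,y)=w_\delta(x\wedge y)$, $x\wedge y$ being the longest common initial segment. $\operatorname{diam}[\lambda]=\sup\{d_\delta(x,y):x,y\in[\lambda]\}$. (Under the diameter hypothesis, $\zeta_\delta(s)=\frac12\mathrm{Tr}(|D|^{-s})$ for the Dirac operator $D=\bigoplus_{\gamma\in F\mathcal{B}_\Lambda}\frac1{\operatorname{diam}[\gamma]}\begin{pmatrix}0&1\\1&0\end{pmatrix}$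 on $\ell^2(F\mathcal{B}_\Lambda)\otimes\mathbb{C}^2$ of the Pearson–Bellissard spectral triple.) *)

theory Defs
  imports "HOL-Analysis.Analysis" "Jordan_Normal_Form.Spectral_Radius"
begin

section \<open>Higher-rank graphs\<close>

text \<open>Elements of \<open>\<nat>\<^sup>k\<close> are functions on the naturals that vanish outside \<open>{1..k}\<close>.\<close>

definition Nk :: "nat \<Rightarrow> (nat \<Rightarrow> nat) set" where
  "Nk k = {m. \<forall>i. i \<notin> {1..k} \<longrightarrow> m i = 0}"

definition Nk_zero :: "nat \<Rightarrow> nat" where
  "Nk_zero = (\<lambda>_. 0)"

definition Nk_add :: "(nat \<Rightarrow> nat) \<Rightarrow> (nat \<Rightarrow> nat) \<Rightarrow> nat \<Rightarrow> nat" where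
  "Nk_add m n = (\<lambda>i. m i + n i)"

definition Nk_unit :: "nat \<Rightarrow> nat \<Rightarrow> nat" where
  "Nk_unit i = (\<lambda>j. if j = i then 1 else 0)"

text \<open>Small categories are given by their morphisms only: objects are identified with identity
  morphisms, so range and source map morphisms to identity morphisms.  The composite
  \<open>kg_comp \<Lambda> f g\<close>, that is \<open>f\<close> after \<open>g\<close>, is meaningful only if \<open>kg_src \<Lambda> f = kg_rng \<Lambda> g\<close>.\<close>

record 'm kgraph =
  kg_mor :: "'m set"
  kg_src :: "'m \<Rightarrow> 'm"
  kg_rng :: "'m \<Rightarrow> 'm"
  kg_comp :: "'m \<Rightarrow> 'm \<Rightarrow> 'm"
  kg_deg :: "'m \<Rightarrow> nat \<Rightarrow> nat"

definition small_category :: "'m kgraph \<Rightarrow> bool" where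
  "small_category \<Lambda> \<longleftrightarrow>
     (\<forall>f\<in>kg_mor \<Lambda>. kg_src \<Lambda> f \<in> kg_mor \<Lambda> \<and> kg_rng \<Lambda> f \<in> kg_mor \<Lambda>) \<and>
     (\<forall>f\<in>kg_mor \<Lambda>.
        kg_src \<Lambda> (kg_src \<Lambda> f) = kg_src \<Lambda> f \<and> kg_rng \<Lambda> (kg_src \<Lambda> f) = kg_src \<Lambda> f \<and>
        kg_src \<Lambda> (kg_rng \<Lambda> f) = kg_rng \<Lambda> f \<and> kg_rng \<Lambda> (kg_rng \<Lambda> f) = kg_rng \<Lambda> f) \<and>
     (\<forall>f\<in>kg_mor \<Lambda>. \<forall>g\<in>kg_mor \<Lambda>. kg_src \<Lambda> f = kg_rng \<Lambda> g \<longrightarrow>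
        kg_comp \<Lambda> f g \<in> kg_mor \<Lambda> \<and>
        kg_src \<Lambda> (kg_comp \<Lambda> f g) = kg_src \<Lambda> g \<and>
        kg_rng \<Lambda> (kg_comp \<Lambda> f g) = kg_rng \<Lambda> f) \<and>
     (\<forall>f\<in>kg_mor \<Lambda>. kg_comp \<Lambda> f (kg_src \<Lambda> f) = f \<and> kg_comp \<Lambda> (kg_rng \<Lambda> f) f = f) \<and>
     (\<forall>f\<in>kg_mor \<Lambda>. \<forall>g\<in>kg_mor \<Lambda>. \<forall>h\<in>kg_mor \<Lambda>.
        kg_src \<Lambda> f = kg_rng \<Lambda> g \<and> kg_src \<Lambda> g = kg_rng \<Lambda> h \<longrightarrow>
        kg_comp \<Lambda> (kg_comp \<Lambda> f g) h = kg_comp \<Lambda> f (kg_comp \<Lambda> g h))"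

definition degree_functor :: "nat \<Rightarrow> 'm kgraph \<Rightarrow> bool" where
  "degree_functor k \<Lambda> \<longleftrightarrow>
     (\<forall>f\<in>kg_mor \<Lambda>. kg_deg \<Lambda> f \<in> Nk k) \<and>
     (\<forall>f\<in>kg_mor \<Lambda>. kg_deg \<Lambda> (kg_src \<Lambda> f) = Nk_zero \<and> kg_deg \<Lambda> (kg_rng \<Lambda> f) = Nk_zero) \<and>
     (\<forall>f\<in>kg_mor \<Lambda>. \<forall>g\<in>kg_mor \<Lambda>. kg_src \<Lambda> f = kg_rng \<Lambda> g \<longrightarrow>
        kg_deg \<Lambda> (kg_comp \<Lambda> f g) = Nk_add (kg_deg \<Lambda> f) (kg_deg \<Lambda> g))"

definition factorization_property :: "nat \<Rightarrow> 'm kgraph \<Rightarrow> bool" where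
  "factorization_property k \<Lambda> \<longleftrightarrow>
     (\<forall>f\<in>kg_mor \<Lambda>. \<forall>m\<in>Nk k. \<forall>n\<in>Nk k. kg_deg \<Lambda> f = Nk_add m n \<longrightarrow>
        (\<exists>!p. fst p \<in> kg_mor \<Lambda> \<and> snd p \<in> kg_mor \<Lambda> \<and>
              kg_deg \<Lambda> (fst p) = m \<and> kg_deg \<Lambda> (snd p) = n \<and>
              kg_src \<Lambda> (fst p) = kg_rng \<Lambda> (snd p) \<and> f = kg_comp \<Lambda> (fst p) (snd p)))"

definition k_graph :: "nat \<Rightarrow> 'm kgraph \<Rightarrow> bool" where
  "k_graph k \<Lambda> \<longleftrightarrow> small_category \<Lambda> \<and> countable (kg_mor \<Lambda>) \<and>
     degree_functor k \<Lambda> \<and> factorization_property k \<Lambda>"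

definition mor_deg :: "'m kgraph \<Rightarrow> (nat \<Rightarrow> nat) \<Rightarrow> 'm set" where
  "mor_deg \<Lambda> n = {f \<in> kg_mor \<Lambda>. kg_deg \<Lambda> f = n}"

definition verts :: "'m kgraph \<Rightarrow> 'm set" where
  "verts \<Lambda> = mor_deg \<Lambda> Nk_zero"

text \<open>Defining the vertices as the morphisms of degree zero agrees with the convention on objects.\<close>

lemma verts_eq_identities:
  assumes "k_graph k \<Lambda>"
  shows "verts \<Lambda> = {v \<in> kg_mor \<Lambda>. kg_src \<Lambda> v = v \<and> kg_rng \<Lambda> v = v}"
proof (intro equalityI subsetI)
  fix v assume v: "v \<in> {v \<in> kg_mor \<Lambda>. kg_src \<Lambda> v = v \<and> kg_rng \<Lambda> v = v}"
  then have "kg_deg \<Lambda> (kg_src \<Lambda> v) = Nk_zero"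
    using assms by (auto simp: k_graph_def degree_functor_def)
  with v show "v \<in> verts \<Lambda>" by (simp add: verts_def mor_deg_def)
next
  fix v assume "v \<in> verts \<Lambda>"
  then have v: "v \<in> kg_mor \<Lambda>" and dv: "kg_deg \<Lambda> v = Nk_zero"
    by (auto simp: verts_def mor_deg_def)
  have cat: "kg_src \<Lambda> v \<in> kg_mor \<Lambda>" "kg_rng \<Lambda> v \<in> kg_mor \<Lambda>"
    "kg_rng \<Lambda> (kg_src \<Lambda> v) = kg_src \<Lambda> v" "kg_src \<Lambda> (kg_rng \<Lambda> v) = kg_rng \<Lambda> v"
    "kg_comp \<Lambda> v (kg_src \<Lambda> v) = v" "kg_comp \<Lambda> (kg_rng \<Lambda> v) v = v"
    using assms v by (auto simp: k_graph_def small_category_def)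
  have deg: "kg_deg \<Lambda> (kg_src \<Lambda> v) = Nk_zero" "kg_deg \<Lambda> (kg_rng \<Lambda> v) = Nk_zero"
    using assms v by (auto simp: k_graph_def degree_functor_def)
  have "Nk_zero \<in> Nk k" and "kg_deg \<Lambda> v = Nk_add Nk_zero Nk_zero"
    using dv by (auto simp: Nk_def Nk_add_def Nk_zero_def)
  then have "\<exists>!p. fst p \<in> kg_mor \<Lambda> \<and> snd p \<in> kg_mor \<Lambda> \<and>
              kg_deg \<Lambda> (fst p) = Nk_zero \<and> kg_deg \<Lambda> (snd p) = Nk_zero \<and>
              kg_src \<Lambda> (fst p) = kg_rng \<Lambda> (snd p) \<and> v = kg_comp \<Lambda> (fst p) (snd p)"
    using assms v by (simp add: k_graph_def factorization_property_def)
  then have "(v, kg_src \<Lambda> v) = (kg_rng \<Lambda> v, v)"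
    by (rule ex1E) (metis cat deg dv v fst_conv snd_conv)
  with v show "v \<in> {v \<in> kg_mor \<Lambda>. kg_src \<Lambda> v = v \<and> kg_rng \<Lambda> v = v}" by simp
qed

definition finite_kgraph :: "nat \<Rightarrow> 'm kgraph \<Rightarrow> bool" where
  "finite_kgraph k \<Lambda> \<longleftrightarrow> (\<forall>n\<in>Nk k. finite (mor_deg \<Lambda> n))"

definition strongly_connected :: "'m kgraph \<Rightarrow> bool" where
  "strongly_connected \<Lambda> \<longleftrightarrow>
     (\<forall>v\<in>verts \<Lambda>. \<forall>w\<in>verts \<Lambda>. \<exists>f\<in>kg_mor \<Lambda>. kg_rng \<Lambda> f = v \<and> kg_src \<Lambda> f = w)"

section \<open>Vertex matrices and Perron-Frobenius data\<close>

definition adj :: "'m kgraph \<Rightarrow> nat \<Rightarrow> 'm \<Rightarrow> 'm \<Rightarrow> nat" where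
  "adj \<Lambda> i v w = card {f \<in> mor_deg \<Lambda> (Nk_unit i). kg_rng \<Lambda> f = v \<and> kg_src \<Lambda> f = w}"

text \<open>The library's spectral radius is defined for matrices with rows and columns numbered from
  \<open>0\<close>, so the finite vertex set is enumerated by \<^const>\<open>from_nat_into\<close>; a different enumeration
  would give a conjugate matrix, with the same spectral radius.\<close>

definition adj_mat :: "'m kgraph \<Rightarrow> nat \<Rightarrow> complex mat" where
  "adj_mat \<Lambda> i = mat (card (verts \<Lambda>)) (card (verts \<Lambda>))
     (\<lambda>(a, b). of_nat (adj \<Lambda> i (from_nat_into (verts \<Lambda>) a) (from_nat_into (verts \<Lambda>) b)))"

definition rho :: "'m kgraph \<Rightarrow> nat \<Rightarrow> real" where
  "rho \<Lambda> i = spectral_radius (adj_mat \<Lambda> i)"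

text \<open>A vector indexed by the vertices is a function on all of \<open>'m\<close> that vanishes off the vertex
  set; without this normalization the description below would not determine it uniquely.\<close>

definition pf_vec :: "nat \<Rightarrow> 'm kgraph \<Rightarrow> 'm \<Rightarrow> real" where
  "pf_vec k \<Lambda> = (THE x.
     (\<forall>v. v \<notin> verts \<Lambda> \<longrightarrow> x v = 0) \<and>
     (\<forall>v\<in>verts \<Lambda>. x v > 0) \<and>
     (\<Sum>v\<in>verts \<Lambda>. x v) = 1 \<and>
     (\<forall>i\<in>{1..k}. \<forall>v\<in>verts \<Lambda>. (\<Sum>w\<in>verts \<Lambda>. real (adj \<Lambda> i v w) * x w) = rho \<Lambda> i * x v))"

section \<open>The stationary Bratteli diagram\<close>

text \<open>The copy of the vertex \<open>p\<close> at level \<open>n\<close> is \<open>(n, p)\<close>.  The edges between levels \<open>n\<close> and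
  \<open>n - 1\<close> with range \<open>p\<close> and source \<open>q\<close> are the tuples \<open>(n, p, q, j)\<close>, with \<open>j\<close> distinguishing
  parallel edges.\<close>

type_synonym 'm bvertex = "nat \<times> 'm"
type_synonym 'm bedge = "nat \<times> 'm \<times> 'm \<times> nat"

definition bverts :: "'m kgraph \<Rightarrow> nat \<Rightarrow> 'm bvertex set" where
  "bverts \<Lambda> n = {n} \<times> verts \<Lambda>"

text \<open>For \<open>n \<ge> 1\<close>, the representative of \<open>n\<close> modulo \<open>k\<close> in \<open>{1..k}\<close>.\<close>

definition level_color :: "nat \<Rightarrow> nat \<Rightarrow> nat" where
  "level_color k n = (n - 1) mod k + 1"

definition bedges :: "nat \<Rightarrow> 'm kgraph \<Rightarrow> nat \<Rightarrow> 'm bedge set" where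
  "bedges k \<Lambda> n = {(n, p, q, j) | p q j.
     p \<in> verts \<Lambda> \<and> q \<in> verts \<Lambda> \<and> j < adj \<Lambda> (level_color k n) p q}"

fun brng :: "'m bedge \<Rightarrow> 'm bvertex" where
  "brng (n, p, q, j) = (n - 1, p)"

fun bsrc :: "'m bedge \<Rightarrow> 'm bvertex" where
  "bsrc (n, p, q, j) = (n, q)"

text \<open>Infinite paths are indexed from \<open>0\<close>: the entry \<open>x n\<close> is the edge in level \<open>n + 1\<close>.\<close>

definition inf_paths :: "nat \<Rightarrow> 'm kgraph \<Rightarrow> (nat \<Rightarrow> 'm bedge) set" where
  "inf_paths k \<Lambda> = {x. \<forall>n. x n \<in> bedges k \<Lambda> (Suc n) \<and> bsrc (x n) = brng (x (Suc n))}"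

text \<open>A finite path is the pair of its range, a vertex of level \<open>0\<close>, and its list of edges; the
  paths of length \<open>0\<close> are thus the vertices of level \<open>0\<close>.\<close>

type_synonym 'm bpath = "'m bvertex \<times> 'm bedge list"

definition fin_paths :: "nat \<Rightarrow> 'm kgraph \<Rightarrow> 'm bpath set" where
  "fin_paths k \<Lambda> = {(p, es).
     p \<in> bverts \<Lambda> 0 \<and>
     (\<forall>j < length es. es ! j \<in> bedges k \<Lambda> (Suc j)) \<and>
     (es \<noteq> [] \<longrightarrow> brng (es ! 0) = p) \<and>
     (\<forall>j. Suc j < length es \<longrightarrow> bsrc (es ! j) = brng (es ! Suc j))}"

definition path_len :: "'m bpath \<Rightarrow> nat" where
  "path_len \<eta> = length (snd \<eta>)"

definition path_src :: "'m bpath \<Rightarrow> 'm bvertex" where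
  "path_src \<eta> = (if snd \<eta> = [] then fst \<eta> else bsrc (last (snd \<eta>)))"

definition init_seg :: "(nat \<Rightarrow> 'm bedge) \<Rightarrow> nat \<Rightarrow> 'm bpath" where
  "init_seg x n = (brng (x 0), map x [0..<n])"

definition cyl :: "nat \<Rightarrow> 'm kgraph \<Rightarrow> 'm bpath \<Rightarrow> (nat \<Rightarrow> 'm bedge) set" where
  "cyl k \<Lambda> \<eta> = {x \<in> inf_paths k \<Lambda>. init_seg x (path_len \<eta>) = \<eta>}"

section \<open>Weight, metric, diameter and zeta function\<close>

definition weight :: "nat \<Rightarrow> 'm kgraph \<Rightarrow> real \<Rightarrow> 'm bpath \<Rightarrow> real" where
  "weight k \<Lambda> \<delta> \<eta> =
     (let q = path_len \<eta> div k; t = path_len \<eta> mod k in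
      ((\<Prod>i\<in>{1..t}. rho \<Lambda> i ^ (q + 1)) * (\<Prod>i\<in>{t+1..k}. rho \<Lambda> i ^ q)) powr (- 1 / \<delta>)
        * pf_vec k \<Lambda> (snd (path_src \<eta>)))"

definition common_segs ::
    "nat \<Rightarrow> 'm kgraph \<Rightarrow> (nat \<Rightarrow> 'm bedge) \<Rightarrow> (nat \<Rightarrow> 'm bedge) \<Rightarrow> 'm bpath set" where
  "common_segs k \<Lambda> x y = {\<eta> \<in> fin_paths k \<Lambda>. x \<in> cyl k \<Lambda> \<eta> \<and> y \<in> cyl k \<Lambda> \<eta>}"

definition meet ::
    "nat \<Rightarrow> 'm kgraph \<Rightarrow> (nat \<Rightarrow> 'm bedge) \<Rightarrow> (nat \<Rightarrow> 'm bedge) \<Rightarrow> 'm bpath" where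
  "meet k \<Lambda> x y = arg_max path_len (\<lambda>\<eta>. \<eta> \<in> common_segs k \<Lambda> x y)"

definition path_dist ::
    "nat \<Rightarrow> 'm kgraph \<Rightarrow> real \<Rightarrow> (nat \<Rightarrow> 'm bedge) \<Rightarrow> (nat \<Rightarrow> 'm bedge) \<Rightarrow> real" where
  "path_dist k \<Lambda> \<delta> x y =
     (if x = y then 0
      else if common_segs k \<Lambda> x y = {} then 1
      else weight k \<Lambda> \<delta> (meet k \<Lambda> x y))"

text \<open>The supremum is taken in \<open>[0, \<infinity>]\<close>; in particular an empty cylinder set has diameter \<open>0\<close>.\<close>

definition cyl_diam :: "nat \<Rightarrow> 'm kgraph \<Rightarrow> real \<Rightarrow> 'm bpath \<Rightarrow> ennreal" where
  "cyl_diam k \<Lambda> \<delta> \<eta> =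
     Sup {ennreal (path_dist k \<Lambda> \<delta> x y) | x y. x \<in> cyl k \<Lambda> \<eta> \<and> y \<in> cyl k \<Lambda> \<eta>}"

definition zeta :: "nat \<Rightarrow> 'm kgraph \<Rightarrow> real \<Rightarrow> real \<Rightarrow> ennreal" where
  "zeta k \<Lambda> \<delta> s = (\<Sum>\<^sub>\<infinity>\<eta>\<in>fin_paths k \<Lambda>. ennreal (weight k \<Lambda> \<delta> \<eta> powr s))"

end

theory Submission
  imports Defs
begin

unbundle no vec_syntax

text \<open>Let \<open>x\<close> be the Perron-Frobenius vector and let \<open>R\<^sub>n\<close> be the product of the spectral radii of
  the colours of the first \<open>n\<close> levels.  Since \<open>x\<close> is an eigenvector of every vertex matrix, the
  entries \<open>x (s \<eta>)\<close> over all paths \<open>\<eta>\<close> of length \<open>n\<close> add up to \<open>R\<^sub>n\<close>.  The entries of \<open>x\<close> lie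
  between positive bounds, so these paths contribute to \<open>\<zeta>(s)\<close> a term comparable with
  \<open>R\<^sub>n powr (1 - s / \<delta>)\<close>.  As \<open>R\<close> is geometric along multiples of \<open>k\<close>, the claim follows once
  \<open>\<rho>\<^sub>1 \<cdots> \<rho>\<^sub>k > 1\<close>.  The diameter hypothesis enters only here: applied to the vertex that
  minimises \<open>x\<close>, it provides two distinct infinite paths from that vertex.  The Perron-Frobenius
  vector itself is that of the irreducible matrix \<open>A\<^sub>1 + \<cdots> + A\<^sub>k\<close>; its eigenspace is a line, hence
  preserved by each \<open>A\<^sub>i\<close> because the \<open>A\<^sub>i\<close> commute.\<close>

section \<open>Perron-Frobenius theory\<close>

definition mat_app :: "'a set \<Rightarrow> ('a \<Rightarrow> 'a \<Rightarrow> real) \<Rightarrow> ('a \<Rightarrow> real) \<Rightarrow> 'a \<Rightarrow> real" where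
  "mat_app V B x v = (\<Sum>w\<in>V. B v w * x w)"

text \<open>Reachability in the graph of positive entries. The closure is reflexive, so the zero
  matrix on a single index counts as irreducible; the results below cover it with eigenvalue
  0.\<close>

definition irreducible_mat :: "'a set \<Rightarrow> ('a \<Rightarrow> 'a \<Rightarrow> real) \<Rightarrow> bool" where
  "irreducible_mat V B \<longleftrightarrow>
     (\<forall>v\<in>V. \<forall>w\<in>V. (v, w) \<in> {(a, b). a \<in> V \<and> b \<in> V \<and> 0 < B a b}\<^sup>*)"

text \<open>Induction along a chain of positive entries. The forward version spreads zeros of a
  nonnegative eigenvector, the backward version spreads positivity, because
  \<open>mat_app V B x a\<close> collects the \<open>x b\<close> with
  \<open>0 < B a b\<close>.\<close>

lemma irreducible_mat_closed_set:
  assumes irr: "irreducible_mat V B" and v: "v \<in> V" "P v"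
    and step: "\<And>a b. a \<in> V \<Longrightarrow> b \<in> V \<Longrightarrow> 0 < B a b \<Longrightarrow> P a \<Longrightarrow> P b"
    and w: "w \<in> V"
  shows "P w"
proof -
  have "(v, w) \<in> {(a, b). a \<in> V \<and> b \<in> V \<and> 0 < B a b}\<^sup>*"
    using irr v w by (auto simp: irreducible_mat_def)
  then show ?thesis
    by (induction rule: rtrancl_induct) (use v step in auto)
qed

lemma irreducible_mat_closed_set_backwards:
  assumes irr: "irreducible_mat V B" and w: "w \<in> V" "P w"
    and step: "\<And>a b. a \<in> V \<Longrightarrow> b \<in> V \<Longrightarrow> 0 < B a b \<Longrightarrow> P b \<Longrightarrow> P a"
    and v: "v \<in> V"
  shows "P v"
  using irreducible_mat_closed_set[OF irr v, of "\<lambda>x. \<not> P x" w] step w by blast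

lemma mat_app_diff_scale: "mat_app V B (\<lambda>v. x v - c * y v) v = mat_app V B x v - c * mat_app V B y v"
  by (simp add: mat_app_def sum_subtractf sum_distrib_left algebra_simps)

lemma mat_app_add: "mat_app V B (\<lambda>v. x v + y v) v = mat_app V B x v + mat_app V B y v"
  by (simp add: mat_app_def sum.distrib algebra_simps)

lemma mat_app_scale: "mat_app V B (\<lambda>v. c * x v) v = c * mat_app V B x v"
  by (simp add: mat_app_def sum_distrib_left algebra_simps)

lemma mat_app_nonneg:
  assumes "\<And>w. w \<in> V \<Longrightarrow> 0 \<le> B v w" "\<And>w. w \<in> V \<Longrightarrow> 0 \<le> x w"
  shows "0 \<le> mat_app V B x v"
  unfolding mat_app_def by (intro sum_nonneg mult_nonneg_nonneg assms)

lemma mat_app_ge_entry: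
  assumes "finite V" "\<And>w. w \<in> V \<Longrightarrow> 0 \<le> B v w" "\<And>w. w \<in> V \<Longrightarrow> 0 \<le> x w" "w \<in> V"
  shows "B v w * x w \<le> mat_app V B x v"
  unfolding mat_app_def by (rule member_le_sum) (use assms in auto)

section \<open>Existence of a positive eigenvector\<close>

text \<open>By Tychonoff: the coordinates in \<open>V\<close> range over the unit interval, those
  outside are frozen at 0, and the sum condition is closed because it involves finitely many
  continuous coordinates.\<close>

lemma compact_simplex_fun:
  fixes V :: "'a set"
  assumes "finite V"
  shows "compact {x :: 'a \<Rightarrow> real. (\<forall>v. v \<notin> V \<longrightarrow> x v = 0) \<and> (\<forall>v\<in>V. 0 \<le> x v) \<and> sum x V = 1}"
    (is "compact ?S")
proof -
  let ?K = "PiE UNIV (\<lambda>v. if v \<in> V then {0..1} else {0::real})"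
  have "compactin (product_topology (\<lambda>_. euclidean) UNIV) ?K"
    by (subst compactin_PiE) auto
  then have K: "compact ?K"
    by (simp add: euclidean_product_topology)
  have cont: "continuous_on UNIV (\<lambda>x :: 'a \<Rightarrow> real. x v)" for v
    by (rule continuous_on_product_coordinates)
  have cl: "closed {x :: 'a \<Rightarrow> real. sum x V = 1}"
    by (intro closed_Collect_eq continuous_on_sum cont continuous_on_const)
  have le1: "x v \<le> 1" if "\<forall>v\<in>V. 0 \<le> x v" "sum x V = 1" "v \<in> V" for x :: "'a \<Rightarrow> real" and v
    using member_le_sum[of v V x] that assms by auto
  have "?S = ?K \<inter> {x. sum x V = 1}"
    using le1 by (fastforce simp: PiE_iff split: if_splits)
  then show ?thesis
    using compact_Int_closed[OF K cl] by simp
qed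

text \<open>Among the maximisers \<open>x\<close> of the largest \<open>t\<close> with \<open>t x \<le> B x\<close>, one whose strict inequalities
  are as many as possible has either none of them, or all; the latter contradicts maximality.\<close>

lemma perron_frobenius_exists_nonneg:
  fixes V :: "'a set"
  assumes fin: "finite V" and ne: "V \<noteq> {}"
    and nn: "\<And>v w. v \<in> V \<Longrightarrow> w \<in> V \<Longrightarrow> 0 \<le> B v w"
    and irr: "irreducible_mat V B"
  obtains x t where "\<And>v. v \<in> V \<Longrightarrow> 0 \<le> x v" "sum x V = 1" "\<And>v. v \<in> V \<Longrightarrow> mat_app V B x v = t * x v"
proof -
  define S where "S = {x :: 'a \<Rightarrow> real. (\<forall>v. v \<notin> V \<longrightarrow> x v = 0) \<and> (\<forall>v\<in>V. 0 \<le> x v) \<and> sum x V = 1}"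
  \<comment> \<open>An a priori bound, proved as \<open>bound\<close> below: on the simplex no
    \<open>r\<close> with \<open>r * x v \<le> mat_app V B x v\<close> for all \<open>v\<close> in
    \<open>V\<close> exceeds \<open>M\<close>. Restricting \<open>t\<close> to \<open>{0..M}\<close>
    thus loses no nonnegative candidate and makes \<open>K\<close> compact.\<close>
  define M where "M = (\<Sum>v\<in>V. \<Sum>w\<in>V. B v w)"
  define K where "K = {(x, t). x \<in> S \<and> t \<in> {0..M} \<and> (\<forall>v\<in>V. t * x v \<le> mat_app V B x v)}"
  have cont: "continuous_on UNIV (\<lambda>p :: ('a \<Rightarrow> real) \<times> real. fst p v)" for v
    by (rule continuous_on_compose2[OF continuous_on_product_coordinates[of v] continuous_on_fst])
       (auto intro: continuous_on_id)
  have cl: "closed (\<Inter>v\<in>V. {p. snd p * fst p v \<le> mat_app V B (fst p) v})"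
    unfolding mat_app_def
    by (intro closed_INT ballI closed_Collect_le continuous_intros cont)
  have "K = (S \<times> {0..M}) \<inter> (\<Inter>v\<in>V. {p. snd p * fst p v \<le> mat_app V B (fst p) v})"
    by (auto simp: K_def)
  moreover have "compact (S \<times> {0..M})"
    unfolding S_def by (intro compact_Times compact_simplex_fun fin compact_Icc)
  ultimately have "compact K"
    using cl by (simp add: compact_Int_closed)
  moreover have "K \<noteq> {}"
  proof -
    obtain u where u: "u \<in> V" using ne by blast
    have "((\<lambda>v. if v = u then 1 else 0), 0) \<in> K"
      using u fin nn by (auto simp: K_def S_def M_def intro!: sum_nonneg mat_app_nonneg)
    then show ?thesis by blast
  qed
  ultimately obtain p where p: "p \<in> K" and pmax: "\<And>q. q \<in> K \<Longrightarrow> snd q \<le> snd p"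
    using continuous_attains_sup[of K snd] continuous_on_snd[OF continuous_on_id] by blast
  define t where "t = snd p"
  have bound: "r \<le> M" if "x \<in> S" "\<forall>v\<in>V. r * x v \<le> mat_app V B x v" for x r
  proof -
    have le1: "x v \<le> 1" if "v \<in> V" for v
      using member_le_sum[of v V x] \<open>x \<in> S\<close> that fin by (auto simp: S_def)
    have "r = (\<Sum>v\<in>V. r * x v)"
      using \<open>x \<in> S\<close> by (simp add: S_def flip: sum_distrib_left)
    also have "\<dots> \<le> (\<Sum>v\<in>V. mat_app V B x v)"
      using that by (intro sum_mono) auto
    also have "\<dots> \<le> M"
      unfolding M_def mat_app_def using nn le1 \<open>x \<in> S\<close>
      by (intro sum_mono) (auto simp: S_def intro: mult_left_le)
    finally show ?thesis .
  qed
  have t0: "0 \<le> t" using p by (auto simp: K_def t_def)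
  have tmax: "r \<le> t" if "x \<in> S" "\<forall>v\<in>V. r * x v \<le> mat_app V B x v" for x r
  proof (cases "0 \<le> r")
    case True
    then have "(x, r) \<in> K" using that bound by (auto simp: K_def)
    from pmax[OF this] show ?thesis by (simp add: t_def)
  qed (use t0 in simp)
  define G where "G x \<longleftrightarrow> x \<in> S \<and> (\<forall>v\<in>V. t * x v \<le> mat_app V B x v)" for x
  define D where "D x = {v\<in>V. t * x v < mat_app V B x v}" for x
  have "G (fst p)" using p by (auto simp: G_def K_def t_def)
  moreover have "\<forall>x. G x \<longrightarrow> card (D x) < Suc (card V)"
    using fin by (auto simp: D_def less_Suc_eq_le intro!: card_mono)
  ultimately obtain x where x: "G x" and cmax: "\<And>y. G y \<Longrightarrow> card (D y) \<le> card (D x)"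
    using ex_has_greatest_nat[of G "fst p" "\<lambda>x. card (D x)" "Suc (card V)"] by blast
  have xS: "x \<in> S" and xt: "\<And>v. v \<in> V \<Longrightarrow> t * x v \<le> mat_app V B x v"
    using x by (auto simp: G_def)
  have x0: "\<And>v. v \<in> V \<Longrightarrow> 0 \<le> x v" and x1: "sum x V = 1"
    using xS by (auto simp: S_def)
  have "D x = {}"
  proof (rule ccontr)
    assume Dne: "D x \<noteq> {}"
    define u where "u v = (if v \<in> V then mat_app V B x v - t * x v else 0)" for v
    have u0: "\<And>v. 0 \<le> u v" using xt by (auto simp: u_def)
    have uD: "v \<in> D x \<longleftrightarrow> v \<in> V \<and> 0 < u v" for v by (auto simp: D_def u_def)
    \<comment> \<open>Passing from \<open>x\<close> to \<open>x + B x\<close>, normalised to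
      \<open>z\<close>, replaces the slack \<open>u\<close> by a positive multiple of
      \<open>u + B u\<close>. Existing strict inequalities survive, and new ones appear wherever
      \<open>B u\<close> is positive.\<close>
    define y where "y v = (if v \<in> V then x v + mat_app V B x v else 0)" for v
    define c where "c = sum y V"
    have Bx0: "0 \<le> mat_app V B x v" if "v \<in> V" for v
      using nn x0 that by (intro mat_app_nonneg) auto
    have "c = 1 + (\<Sum>v\<in>V. mat_app V B x v)"
      by (simp add: c_def y_def sum.distrib x1)
    then have c: "1 \<le> c" using Bx0 by (simp add: sum_nonneg)
    define z where "z v = inverse c * y v" for v
    have zS: "z \<in> S"
      using c x0 Bx0 by (auto simp: S_def z_def y_def c_def simp flip: sum_distrib_left)
    have Bcong: "mat_app V B f v = mat_app V B g v" if "\<And>w. w \<in> V \<Longrightarrow> f w = g w" for f g v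
      unfolding mat_app_def using that by (intro sum.cong) auto
    have Bz: "mat_app V B z v - t * z v = inverse c * (u v + mat_app V B u v)" if "v \<in> V" for v
    proof -
      have "mat_app V B y v = mat_app V B x v + mat_app V B (mat_app V B x) v"
        by (subst mat_app_add[symmetric], rule Bcong) (auto simp: y_def)
      moreover have "mat_app V B (mat_app V B x) v = mat_app V B u v + t * mat_app V B x v"
      proof -
        have "mat_app V B u v = mat_app V B (mat_app V B x) v - t * mat_app V B x v"
          by (subst mat_app_diff_scale[symmetric], rule Bcong) (auto simp: u_def)
        then show ?thesis by simp
      qed
      moreover have "mat_app V B z v = inverse c * mat_app V B y v"
        unfolding z_def by (rule mat_app_scale)
      ultimately show ?thesis using that by (simp add: z_def y_def[of v] u_def[of v] algebra_simps)
    qed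
    have Bu0: "0 \<le> mat_app V B u v" if "v \<in> V" for v
      using nn u0 that by (intro mat_app_nonneg) auto
    have Dz: "v \<in> D z \<longleftrightarrow> v \<in> V \<and> 0 < u v + mat_app V B u v" for v
    proof -
      have "t * z v < mat_app V B z v \<longleftrightarrow> 0 < u v + mat_app V B u v" if "v \<in> V"
      proof -
        have "t * z v < mat_app V B z v \<longleftrightarrow> 0 < inverse c * (u v + mat_app V B u v)"
          unfolding Bz[OF that, symmetric] by simp
        then show ?thesis using c by (simp add: zero_less_mult_iff)
      qed
      then show ?thesis unfolding D_def by blast
    qed
    have Gz: "G z"
    proof -
      have "0 \<le> mat_app V B z v - t * z v" if "v \<in> V" for v
        unfolding Bz[OF that] using c u0 Bu0[OF that] by simp
      then show ?thesis using zS by (auto simp: G_def)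
    qed
    have "D x \<subseteq> D z"
      by (auto simp: uD Dz intro!: add_pos_nonneg Bu0)
    moreover have "finite (D z)" using fin by (simp add: D_def)
    ultimately have Deq: "D x = D z"
      using cmax[OF Gz] by (metis card_seteq)
    obtain w0 where w0: "w0 \<in> D x" using Dne by blast
    \<comment> \<open>Since \<open>z\<close> gains no strict inequality over \<open>x\<close>, the
      set \<open>D x\<close> already contains every \<open>a\<close> with \<open>0 < B a b\<close>
      for some \<open>b\<close> in \<open>D x\<close>; irreducibility then makes it all of
      \<open>V\<close>.\<close>
    have all: "v \<in> D x" if "v \<in> V" for v
    proof (rule irreducible_mat_closed_set_backwards[OF irr, of w0 "\<lambda>v. v \<in> D x"])
      fix a b assume ab: "a \<in> V" "b \<in> V" "0 < B a b" "b \<in> D x"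
      have "0 < B a b * u b" using ab by (simp add: uD)
      also have "\<dots> \<le> mat_app V B u a"
        using ab nn u0 fin by (intro mat_app_ge_entry) auto
      finally have "a \<in> D z" using ab u0[of a] by (simp add: Dz)
      then show "a \<in> D x" using Deq by simp
    qed (use w0 that in \<open>auto simp: D_def\<close>)
    \<comment> \<open>With slack at every index, the least slack can be added to \<open>t\<close>,
      because \<open>x v \<le> 1\<close> gives \<open>e * x v \<le> u v\<close>. This violates the
      maximality of \<open>t\<close>.\<close>
    define e where "e = Min (u ` V)"
    have e: "0 < e" unfolding e_def using fin ne all uD by (subst Min_gr_iff) auto
    have "t + e \<le> t"
    proof (rule tmax[OF xS], intro ballI)
      fix v assume v: "v \<in> V"
      have "e \<le> u v" unfolding e_def using fin v by simp
      moreover have "x v \<le> 1" using member_le_sum[of v V x] fin v x0 x1 by auto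
      ultimately have "e * x v \<le> u v"
        using e x0[OF v] by (meson less_imp_le mult_left_le order_trans)
      then show "(t + e) * x v \<le> mat_app V B x v"
        using v by (simp add: u_def algebra_simps)
    qed
    then show False using e by simp
  qed
  then have "mat_app V B x v = t * x v" if "v \<in> V" for v
    using xt[OF that] that by (force simp: D_def)
  then show ?thesis using that x0 x1 by blast
qed

text \<open>The entries sum to 1, so some entry is positive. Positivity moves from \<open>b\<close>
  to \<open>a\<close> whenever \<open>0 < B a b\<close>, since then \<open>t * x a\<close> is at
  least \<open>B a b * x b\<close>.\<close>

lemma perron_frobenius_exists:
  assumes fin: "finite V" and ne: "V \<noteq> {}"
    and nn: "\<And>v w. v \<in> V \<Longrightarrow> w \<in> V \<Longrightarrow> 0 \<le> B v w"
    and irr: "irreducible_mat V B"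
  obtains x t where "\<And>v. v \<in> V \<Longrightarrow> 0 < x v" "sum x V = 1" "\<And>v. v \<in> V \<Longrightarrow> mat_app V B x v = t * x v"
proof -
  obtain x t where x: "\<And>v. v \<in> V \<Longrightarrow> 0 \<le> x v" "sum x V = 1"
    "\<And>v. v \<in> V \<Longrightarrow> mat_app V B x v = t * x v"
    using perron_frobenius_exists_nonneg[OF assms] by blast
  have "\<exists>u\<in>V. x u \<noteq> 0"
    using x(2) by (metis sum.neutral zero_neq_one)
  then obtain u where u: "u \<in> V" "0 < x u" using x(1) by force
  have "0 < x v" if "v \<in> V" for v
  proof (rule irreducible_mat_closed_set_backwards[OF irr, of u "\<lambda>v. 0 < x v"])
    fix a b assume ab: "a \<in> V" "b \<in> V" "0 < B a b" "0 < x b"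
    have "0 < B a b * x b" using ab by simp
    also have "\<dots> \<le> mat_app V B x a"
      using ab nn x(1) fin by (intro mat_app_ge_entry) auto
    also have "\<dots> = t * x a" using ab x(3) by simp
    finally show "0 < x a" using x(1)[OF ab(1)] by (cases "x a = 0") auto
  qed (use u that in auto)
  with x show ?thesis using that by blast
qed

section \<open>Uniqueness, common eigenvectors and the spectral radius\<close>

text \<open>Subtract from \<open>y\<close> the largest multiple of \<open>x\<close> that leaves a
  nonnegative difference. The difference is a nonnegative eigenvector with a zero entry, and
  irreducibility spreads this zero to all of \<open>V\<close>.\<close>

lemma irreducible_eigenvector_proportional:
  assumes fin: "finite V" and ne: "V \<noteq> {}"
    and nn: "\<And>v w. v \<in> V \<Longrightarrow> w \<in> V \<Longrightarrow> 0 \<le> B v w"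
    and irr: "irreducible_mat V B"
    and x: "\<And>v. v \<in> V \<Longrightarrow> 0 < x v" "\<And>v. v \<in> V \<Longrightarrow> mat_app V B x v = t * x v"
    and y: "\<And>v. v \<in> V \<Longrightarrow> mat_app V B y v = t * y v"
  obtains c where "\<And>v. v \<in> V \<Longrightarrow> y v = c * x v"
proof -
  define c where "c = Min ((\<lambda>v. y v / x v) ` V)"
  define z where "z v = y v - c * x v" for v
  have "c \<in> (\<lambda>v. y v / x v) ` V" unfolding c_def using fin ne by (intro Min_in) auto
  then obtain u where u: "u \<in> V" "c = y u / x u" by blast
  have z0: "0 \<le> z v" if "v \<in> V" for v
  proof -
    have "c \<le> y v / x v" unfolding c_def using fin that by simp
    then show ?thesis using x(1)[OF that] by (simp add: z_def field_simps)
  qed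
  have Bz: "mat_app V B z v = t * z v" if "v \<in> V" for v
    unfolding z_def mat_app_diff_scale using x(2) y that by (simp add: algebra_simps)
  have "z v = 0" if "v \<in> V" for v
  proof (rule irreducible_mat_closed_set[OF irr u(1), of "\<lambda>v. z v = 0"])
    show "z u = 0" using x(1)[OF u(1)] u(2) by (simp add: z_def)
    fix a b assume ab: "a \<in> V" "b \<in> V" "0 < B a b" "z a = 0"
    have "B a b * z b \<le> mat_app V B z a"
      using ab nn z0 fin by (intro mat_app_ge_entry) auto
    also have "\<dots> = 0" using Bz ab by simp
    finally show "z b = 0" using ab(3) z0[OF ab(2)] by (simp add: mult_le_0_iff)
  qed (fact that)
  then show ?thesis using that[of c] by (auto simp: z_def)
qed

text \<open>The scalars \<open>l i\<close> are left unspecified here;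
  \<open>spectral_radius_eq_positive_eigenvalue\<close> identifies them afterwards from the
  positivity of \<open>x\<close>.\<close>

lemma commuting_common_positive_eigenvector:
  fixes A :: "'i \<Rightarrow> 'a \<Rightarrow> 'a \<Rightarrow> real"
  assumes fin: "finite V" and ne: "V \<noteq> {}"
    and nn: "\<And>i v w. i \<in> I \<Longrightarrow> v \<in> V \<Longrightarrow> w \<in> V \<Longrightarrow> 0 \<le> A i v w"
    and comm: "\<And>i j v w. i \<in> I \<Longrightarrow> j \<in> I \<Longrightarrow> v \<in> V \<Longrightarrow> w \<in> V \<Longrightarrow>
        (\<Sum>u\<in>V. A i v u * A j u w) = (\<Sum>u\<in>V. A j v u * A i u w)"
    and irr: "irreducible_mat V (\<lambda>v w. \<Sum>i\<in>I. A i v w)"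
  obtains x l where "\<And>v. v \<in> V \<Longrightarrow> 0 < x v" "sum x V = 1"
    "\<And>i v. i \<in> I \<Longrightarrow> v \<in> V \<Longrightarrow> mat_app V (A i) x v = l i * x v"
proof -
  define B where "B v w = (\<Sum>i\<in>I. A i v w)" for v w
  have irrB: "irreducible_mat V B" using irr by (simp add: B_def [abs_def])
  have nnB: "0 \<le> B v w" if "v \<in> V" "w \<in> V" for v w
    using nn that by (auto simp: B_def intro: sum_nonneg)
  obtain x t where x: "\<And>v. v \<in> V \<Longrightarrow> 0 < x v" "sum x V = 1"
    "\<And>v. v \<in> V \<Longrightarrow> mat_app V B x v = t * x v"
    using perron_frobenius_exists[OF fin ne nnB irrB] by blast
  have "\<exists>c. \<forall>v\<in>V. mat_app V (A i) x v = c * x v" if i: "i \<in> I" for i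
  proof -
    have mm: "mat_app V P (mat_app V Q x) v = (\<Sum>w\<in>V. (\<Sum>u\<in>V. P v u * Q u w) * x w)" for P Q v
      unfolding mat_app_def sum_distrib_left sum_distrib_right
      by (subst sum.swap) (simp add: mult.assoc)
    have BA: "(\<Sum>u\<in>V. B v u * A i u w) = (\<Sum>u\<in>V. A i v u * B u w)" if "v \<in> V" "w \<in> V" for v w
    proof -
      have "(\<Sum>u\<in>V. B v u * A i u w) = (\<Sum>j\<in>I. \<Sum>u\<in>V. A j v u * A i u w)"
        unfolding B_def sum_distrib_right by (rule sum.swap)
      also have "\<dots> = (\<Sum>j\<in>I. \<Sum>u\<in>V. A i v u * A j u w)"
        by (rule sum.cong[OF refl], rule comm) (use i that in auto)
      also have "\<dots> = (\<Sum>u\<in>V. A i v u * B u w)"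
        unfolding B_def sum_distrib_left by (rule sum.swap)
      finally show ?thesis .
    qed
    have ev: "mat_app V B (mat_app V (A i) x) v = t * mat_app V (A i) x v" if v: "v \<in> V" for v
    proof -
      have "mat_app V B (mat_app V (A i) x) v = mat_app V (A i) (mat_app V B x) v"
        unfolding mm using BA v by (intro sum.cong) auto
      also have "\<dots> = mat_app V (A i) (\<lambda>w. t * x w) v"
        unfolding mat_app_def[of V "A i"] using x(3) by (intro sum.cong) auto
      finally show ?thesis by (simp add: mat_app_scale)
    qed
    show ?thesis
      using irreducible_eigenvector_proportional[OF fin ne nnB irrB x(1) x(3) ev] by metis
  qed
  then obtain l where "\<And>i v. i \<in> I \<Longrightarrow> v \<in> V \<Longrightarrow> mat_app V (A i) x v = l i * x v" by metis
  with x show ?thesis using that by blast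
qed

text \<open>An eigenvector is dominated entrywise by a multiple of \<open>x\<close>; comparing at an entry where the
  domination is sharp bounds its eigenvalue.\<close>

lemma spectral_radius_eq_positive_eigenvalue:
  fixes A :: "'a \<Rightarrow> 'a \<Rightarrow> real"
  assumes fin: "finite V" and ne: "V \<noteq> {}"
    and nn: "\<And>v w. v \<in> V \<Longrightarrow> w \<in> V \<Longrightarrow> 0 \<le> A v w"
    and x: "\<And>v. v \<in> V \<Longrightarrow> 0 < x v" "\<And>v. v \<in> V \<Longrightarrow> mat_app V A x v = l * x v"
  shows "spectral_radius (mat (card V) (card V)
    (\<lambda>(a, b). complex_of_real (A (from_nat_into V a) (from_nat_into V b)))) = l"
proof -
  define n where "n = card V"
  define e where "e = from_nat_into V"
  define M where "M = mat n n (\<lambda>(a, b). complex_of_real (A (e a) (e b)))"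
  have n: "0 < n" using fin ne by (simp add: n_def card_gt_0_iff)
  have bij: "bij_betw e {..<n} V"
    unfolding e_def n_def by (rule bij_betw_from_nat_into_finite[OF fin])
  have eV: "e a \<in> V" if "a < n" for a using bij that by (auto simp: bij_betw_def)
  have M: "M \<in> carrier_mat n n" by (simp add: M_def)
  have Mv: "(M *\<^sub>v z) $ a = (\<Sum>b<n. complex_of_real (A (e a) (e b)) * z $ b)"
    if "z \<in> carrier_vec n" "a < n" for z a
    using that by (simp add: M_def scalar_prod_def atLeast0LessThan)
  have sumV: "(\<Sum>b<n. f (e b)) = sum f V" for f :: "'a \<Rightarrow> real"
    by (rule sum.reindex_bij_betw[OF bij])
  \<comment> \<open>The spectral radius compares moduli, and \<open>cmod (complex_of_real l)\<close>
    is \<open>l\<close> only for nonnegative \<open>l\<close>.\<close>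
  have l0: "0 \<le> l"
  proof -
    obtain v where v: "v \<in> V" using ne by blast
    have "0 \<le> mat_app V A x v" using nn x(1) v by (intro mat_app_nonneg) (auto intro: less_imp_le)
    then show ?thesis using x v by (simp add: zero_le_mult_iff) (metis linorder_not_less)
  qed
  have le: "cmod \<mu> \<le> l" if ev: "eigenvalue M \<mu>" for \<mu>
  proof -
    obtain z where z: "z \<in> carrier_vec n" "z \<noteq> 0\<^sub>v n" "M *\<^sub>v z = \<mu> \<cdot>\<^sub>v z"
      using ev M by (auto simp: eigenvalue_def eigenvector_def)
    define h where "h a = cmod (z $ a) / x (e a)" for a
    define c where "c = Max (h ` {..<n})"
    have "c \<in> h ` {..<n}" unfolding c_def using n by (intro Max_in) auto
    then obtain a where a: "a < n" "c = h a" by auto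
    have hc: "cmod (z $ b) \<le> c * x (e b)" if "b < n" for b
    proof -
      have "h b \<le> c" unfolding c_def using that by simp
      then show ?thesis using x(1)[OF eV[OF that]] by (simp add: h_def field_simps)
    qed
    have "0 < c"
    proof -
      obtain b where b: "b < n" "z $ b \<noteq> 0"
        using z(1,2) by (metis carrier_vecD eq_vecI index_zero_vec)
      then have "0 < c * x (e b)" using hc[OF b(1)] by (meson less_le_trans zero_less_norm_iff)
      then show ?thesis using x(1)[OF eV[OF b(1)]] by (simp add: zero_less_mult_iff)
    qed
    have xa: "0 < x (e a)" using x(1) eV a by simp
    have "cmod \<mu> * (c * x (e a)) = cmod (\<mu> * z $ a)"
      using xa a by (simp add: h_def norm_mult)
    also have "\<mu> * z $ a = (\<Sum>b<n. complex_of_real (A (e a) (e b)) * z $ b)"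
      using Mv[OF z(1) a(1)] z a(1) by simp
    also have "cmod \<dots> \<le> (\<Sum>b<n. A (e a) (e b) * (c * x (e b)))"
      using nn eV a hc by (intro sum_norm_le) (auto simp: norm_mult intro!: mult_left_mono)
    also have "\<dots> = c * mat_app V A x (e a)"
      unfolding mat_app_def sum_distrib_left by (subst sumV) (simp add: mult_ac)
    also have "\<dots> = l * (c * x (e a))" using x(2) eV a by simp
    finally show ?thesis using \<open>0 < c\<close> xa by simp
  qed
  have "eigenvalue M (complex_of_real l)"
  proof -
    define z where "z = vec n (\<lambda>a. complex_of_real (x (e a)))"
    have zc: "z \<in> carrier_vec n" by (simp add: z_def)
    have "z $ 0 \<noteq> 0\<^sub>v n $ 0" using n x(1)[OF eV[of 0]] by (simp add: z_def)
    then have "z \<noteq> 0\<^sub>v n" by metis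
    moreover have "M *\<^sub>v z = complex_of_real l \<cdot>\<^sub>v z"
    proof (rule eq_vecI)
      fix a assume "a < dim_vec (complex_of_real l \<cdot>\<^sub>v z)"
      then have a: "a < n" by (simp add: z_def)
      have "(M *\<^sub>v z) $ a = complex_of_real (\<Sum>b<n. A (e a) (e b) * x (e b))"
        using Mv[OF zc a] by (simp add: z_def)
      also have "(\<Sum>b<n. A (e a) (e b) * x (e b)) = mat_app V A x (e a)"
        unfolding mat_app_def by (rule sumV)
      finally show "(M *\<^sub>v z) $ a = (complex_of_real l \<cdot>\<^sub>v z) $ a"
        using a x(2)[OF eV[OF a]] by (simp add: z_def)
    qed (simp add: M_def z_def)
    ultimately show ?thesis
      using M zc by (auto simp: eigenvalue_def eigenvector_def)
  qed
  then have "cmod (complex_of_real l) \<in> norm ` spectrum M"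
    unfolding spectrum_def by (intro imageI) simp
  from spectral_radius_mem_max(2)[OF M n this] have "l \<le> spectral_radius M" using l0 by simp
  moreover have "spectral_radius M \<le> l"
    using spectral_radius_mem_max(1)[OF M n] le by (auto simp: spectrum_def)
  ultimately show ?thesis by (simp add: M_def n_def e_def)
qed

section \<open>Vertex matrices of a higher-rank graph\<close>

context
  fixes \<Lambda> :: "'m kgraph" and k :: nat
  assumes kg: "k_graph k \<Lambda>"
begin

lemma src_in_verts: "f \<in> kg_mor \<Lambda> \<Longrightarrow> kg_src \<Lambda> f \<in> verts \<Lambda>"
  and rng_in_verts: "f \<in> kg_mor \<Lambda> \<Longrightarrow> kg_rng \<Lambda> f \<in> verts \<Lambda>"
  using kg by (auto simp: k_graph_def small_category_def degree_functor_def verts_def mor_deg_def)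

lemma comp_mor:
  assumes "f \<in> kg_mor \<Lambda>" "g \<in> kg_mor \<Lambda>" "kg_src \<Lambda> f = kg_rng \<Lambda> g"
  shows "kg_comp \<Lambda> f g \<in> kg_mor \<Lambda>" "kg_src \<Lambda> (kg_comp \<Lambda> f g) = kg_src \<Lambda> g"
    "kg_rng \<Lambda> (kg_comp \<Lambda> f g) = kg_rng \<Lambda> f"
    "kg_deg \<Lambda> (kg_comp \<Lambda> f g) = Nk_add (kg_deg \<Lambda> f) (kg_deg \<Lambda> g)"
  using kg assms by (auto simp: k_graph_def small_category_def degree_functor_def)

lemma factorization_ex1:
  assumes "f \<in> kg_mor \<Lambda>" "m \<in> Nk k" "n \<in> Nk k" "kg_deg \<Lambda> f = Nk_add m n"
  shows "\<exists>!p. fst p \<in> kg_mor \<Lambda> \<and> snd p \<in> kg_mor \<Lambda> \<and>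
              kg_deg \<Lambda> (fst p) = m \<and> kg_deg \<Lambda> (snd p) = n \<and>
              kg_src \<Lambda> (fst p) = kg_rng \<Lambda> (snd p) \<and> f = kg_comp \<Lambda> (fst p) (snd p)"
  using kg assms by (simp add: k_graph_def factorization_property_def)

lemma factorization_obtain:
  assumes "f \<in> kg_mor \<Lambda>" "m \<in> Nk k" "n \<in> Nk k" "kg_deg \<Lambda> f = Nk_add m n"
  obtains g h where "g \<in> kg_mor \<Lambda>" "h \<in> kg_mor \<Lambda>" "kg_deg \<Lambda> g = m" "kg_deg \<Lambda> h = n"
    "kg_src \<Lambda> g = kg_rng \<Lambda> h" "f = kg_comp \<Lambda> g h"
  using ex1_implies_ex[OF factorization_ex1[OF assms]] by blast

lemma factorization_unique:
  assumes "g \<in> kg_mor \<Lambda>" "h \<in> kg_mor \<Lambda>" "kg_src \<Lambda> g = kg_rng \<Lambda> h"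
    and "g' \<in> kg_mor \<Lambda>" "h' \<in> kg_mor \<Lambda>" "kg_src \<Lambda> g' = kg_rng \<Lambda> h'"
    and "kg_deg \<Lambda> g' = kg_deg \<Lambda> g" "kg_deg \<Lambda> h' = kg_deg \<Lambda> h"
    and "kg_comp \<Lambda> g h = kg_comp \<Lambda> g' h'"
  shows "g = g'" "h = h'"
proof -
  have "kg_deg \<Lambda> g \<in> Nk k" "kg_deg \<Lambda> h \<in> Nk k"
    using kg assms by (auto simp: k_graph_def degree_functor_def)
  note ex1 = factorization_ex1[OF comp_mor(1)[OF assms(1-3)] this comp_mor(4)[OF assms(1-3)]]
  have uniq: "a = b" if "\<exists>!p. P p" "P a" "P b" for P and a b :: "'m \<times> 'm"
    using that by blast
  have "(g, h) = (g', h')"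
    by (rule uniq[OF ex1]) (use assms in auto)
  then show "g = g'" "h = h'" by auto
qed

section \<open>Commutation and irreducibility of the vertex matrices\<close>

text \<open>Composition maps composable pairs of an edge of colour \<open>i\<close> and one of
  colour \<open>j\<close> bijectively onto the morphisms of the summed degree: existence of
  factorizations gives surjectivity, uniqueness gives injectivity. The count is symmetric in
  \<open>i\<close> and \<open>j\<close>, whence \<open>adj_commute\<close>.\<close>

lemma adj_product_eq_card:
  assumes fin: "finite_kgraph k \<Lambda>" and ij: "i \<in> {1..k}" "j \<in> {1..k}"
  shows "(\<Sum>u\<in>verts \<Lambda>. adj \<Lambda> i v u * adj \<Lambda> j u w) =
    card {f \<in> mor_deg \<Lambda> (Nk_add (Nk_unit i) (Nk_unit j)). kg_rng \<Lambda> f = v \<and> kg_src \<Lambda> f = w}"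
proof -
  define E where "E i v w = {f \<in> mor_deg \<Lambda> (Nk_unit i). kg_rng \<Lambda> f = v \<and> kg_src \<Lambda> f = w}" for i v w
  have unit: "Nk_unit i \<in> Nk k" "Nk_unit j \<in> Nk k" and zero: "Nk_zero \<in> Nk k"
    using ij by (auto simp: Nk_def Nk_unit_def Nk_zero_def)
  have finE: "finite (E i v u)" "finite (E j u w)" for u
    using fin unit by (auto simp: E_def finite_kgraph_def)
  have finV: "finite (verts \<Lambda>)"
    using fin zero by (simp add: finite_kgraph_def verts_def)
  let ?S = "SIGMA u:verts \<Lambda>. E i v u \<times> E j u w"
  let ?T = "{f \<in> mor_deg \<Lambda> (Nk_add (Nk_unit i) (Nk_unit j)). kg_rng \<Lambda> f = v \<and> kg_src \<Lambda> f = w}"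
  let ?c = "\<lambda>(u, f, g). kg_comp \<Lambda> f g"
  have E: "f \<in> E a b c \<longleftrightarrow> f \<in> kg_mor \<Lambda> \<and> kg_deg \<Lambda> f = Nk_unit a \<and> kg_rng \<Lambda> f = b \<and> kg_src \<Lambda> f = c"
    for f a b c by (auto simp: E_def mor_deg_def)
  have "bij_betw ?c ?S ?T"
    unfolding bij_betw_def
  proof (intro conjI equalityI subsetI)
    show "inj_on ?c ?S"
    proof (rule inj_onI)
      fix p q assume pq: "p \<in> ?S" "q \<in> ?S" "?c p = ?c q"
      obtain u f g u' f' g' where "p = (u, f, g)" "q = (u', f', g')" by (metis prod_cases3)
      then show "p = q"
        using pq factorization_unique[of f g f' g'] by (auto simp: E)
    qed
    show "f \<in> ?T" if "f \<in> ?c ` ?S" for f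
      using that comp_mor by (auto simp: E mor_deg_def)
    fix f assume f: "f \<in> ?T"
    then obtain g h where gh: "g \<in> kg_mor \<Lambda>" "h \<in> kg_mor \<Lambda>" "kg_deg \<Lambda> g = Nk_unit i"
      "kg_deg \<Lambda> h = Nk_unit j" "kg_src \<Lambda> g = kg_rng \<Lambda> h" "f = kg_comp \<Lambda> g h"
      using factorization_obtain[OF _ unit] by (auto simp: mor_deg_def)
    then have "(kg_src \<Lambda> g, g, h) \<in> ?S"
      using f comp_mor[of g h] src_in_verts[of g] by (auto simp: E)
    then show "f \<in> ?c ` ?S" using gh(6) by force
  qed
  then have "card ?T = card ?S" by (simp add: bij_betw_same_card)
  also have "\<dots> = (\<Sum>u\<in>verts \<Lambda>. card (E i v u) * card (E j u w))"
    using finE finV by (simp add: card_SigmaI card_cartesian_product)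
  finally show ?thesis by (simp add: adj_def E_def)
qed

lemma adj_commute:
  assumes "finite_kgraph k \<Lambda>" "i \<in> {1..k}" "j \<in> {1..k}"
  shows "(\<Sum>u\<in>verts \<Lambda>. adj \<Lambda> i v u * adj \<Lambda> j u w) = (\<Sum>u\<in>verts \<Lambda>. adj \<Lambda> j v u * adj \<Lambda> i u w)"
proof -
  have "Nk_add (Nk_unit i) (Nk_unit j) = Nk_add (Nk_unit j) (Nk_unit i)"
    by (auto simp: Nk_add_def)
  then show ?thesis using assms by (simp add: adj_product_eq_card)
qed

lemma adj_pos:
  assumes "finite_kgraph k \<Lambda>" "i \<in> {1..k}" "f \<in> kg_mor \<Lambda>" "kg_deg \<Lambda> f = Nk_unit i"
  shows "0 < adj \<Lambda> i (kg_rng \<Lambda> f) (kg_src \<Lambda> f)"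
proof -
  have "Nk_unit i \<in> Nk k" using assms by (auto simp: Nk_def Nk_unit_def)
  then have "finite {g \<in> mor_deg \<Lambda> (Nk_unit i). kg_rng \<Lambda> g = kg_rng \<Lambda> f \<and> kg_src \<Lambda> g = kg_src \<Lambda> f}"
    using assms by (auto simp: finite_kgraph_def)
  then show ?thesis
    unfolding adj_def card_gt_0_iff using assms by (auto simp: mor_deg_def)
qed

text \<open>Induction on the total degree: the factorization property splits off an edge of some
  colour occurring in the degree. A morphism of degree zero is a vertex, so its range and source
  coincide and the reflexive closure suffices.\<close>

lemma morphism_edge_path:
  assumes fin: "finite_kgraph k \<Lambda>" and f: "f \<in> kg_mor \<Lambda>"
  shows "(kg_rng \<Lambda> f, kg_src \<Lambda> f) \<in>
    {(a, b). a \<in> verts \<Lambda> \<and> b \<in> verts \<Lambda> \<and> 0 < (\<Sum>i\<in>{1..k}. real (adj \<Lambda> i a b))}\<^sup>*"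
    (is "_ \<in> ?R\<^sup>*")
  using f
proof (induction "sum (kg_deg \<Lambda> f) {1..k}" arbitrary: f rule: less_induct)
  case less
  have dN: "kg_deg \<Lambda> f \<in> Nk k" using kg less.prems by (auto simp: k_graph_def degree_functor_def)
  show ?case
  proof (cases "kg_deg \<Lambda> f = Nk_zero")
    case True
    then have "f \<in> verts \<Lambda>" using less.prems by (simp add: verts_def mor_deg_def)
    then show ?thesis using verts_eq_identities[OF kg] by auto
  next
    case False
    then obtain i where i: "kg_deg \<Lambda> f i \<noteq> 0" by (auto simp: Nk_zero_def)
    then have ik: "i \<in> {1..k}" using dN by (auto simp: Nk_def)
    define n where "n j = (if j = i then kg_deg \<Lambda> f i - 1 else kg_deg \<Lambda> f j)" for j
    have "Nk_unit i \<in> Nk k" "n \<in> Nk k" "kg_deg \<Lambda> f = Nk_add (Nk_unit i) n"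
      using ik dN i by (auto simp: Nk_def Nk_unit_def Nk_add_def n_def fun_eq_iff)
    from factorization_obtain[OF less.prems this]
    obtain g h where gh: "g \<in> kg_mor \<Lambda>" "h \<in> kg_mor \<Lambda>" "kg_deg \<Lambda> g = Nk_unit i" "kg_deg \<Lambda> h = n"
      "kg_src \<Lambda> g = kg_rng \<Lambda> h" "f = kg_comp \<Lambda> g h" by metis
    have "sum n {1..k} < sum (kg_deg \<Lambda> f) {1..k}"
      using ik i by (intro sum_strict_mono_ex1) (auto simp: n_def intro!: bexI[of _ i])
    then have IH: "(kg_rng \<Lambda> h, kg_src \<Lambda> h) \<in> ?R\<^sup>*"
      using less.hyps gh by simp
    have "0 < (\<Sum>i\<in>{1..k}. real (adj \<Lambda> i (kg_rng \<Lambda> g) (kg_src \<Lambda> g)))"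
      using ik adj_pos[OF fin ik gh(1,3)] by (intro sum_pos2[of _ i]) auto
    then have "(kg_rng \<Lambda> g, kg_rng \<Lambda> h) \<in> ?R"
      using gh rng_in_verts by auto
    moreover have "kg_rng \<Lambda> f = kg_rng \<Lambda> g" "kg_src \<Lambda> f = kg_src \<Lambda> h"
      using comp_mor[OF gh(1,2,5)] gh(6) by auto
    ultimately show ?thesis
      using converse_rtrancl_into_rtrancl[OF _ IH] by (simp only:)
  qed
qed

lemma finite_verts:
  assumes "finite_kgraph k \<Lambda>"
  shows "finite (verts \<Lambda>)"
  using assms by (auto simp: finite_kgraph_def verts_def Nk_def Nk_zero_def)

lemma irreducible_adj_sum:
  assumes "finite_kgraph k \<Lambda>" "strongly_connected \<Lambda>"
  shows "irreducible_mat (verts \<Lambda>) (\<lambda>a b. \<Sum>i\<in>{1..k}. real (adj \<Lambda> i a b))"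
  unfolding irreducible_mat_def using assms morphism_edge_path
  by (fastforce simp: strongly_connected_def)

section \<open>The Perron-Frobenius vector of the graph\<close>

lemma rho_eq_positive_eigenvalue:
  assumes "finite_kgraph k \<Lambda>" "verts \<Lambda> \<noteq> {}"
    and "\<And>v. v \<in> verts \<Lambda> \<Longrightarrow> 0 < x v"
    and "\<And>v. v \<in> verts \<Lambda> \<Longrightarrow> mat_app (verts \<Lambda>) (\<lambda>v w. real (adj \<Lambda> i v w)) x v = l * x v"
  shows "rho \<Lambda> i = l"
  using spectral_radius_eq_positive_eigenvalue[OF finite_verts assms(2) _ assms(3,4)] assms(1)
  by (simp add: rho_def adj_mat_def)

text \<open>Unfolding the \<open>THE\<close> in \<open>pf_vec\<close> requires existence and
  uniqueness. Existence: the common positive eigenvector, cut off to 0 outside the vertices, has the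
  numbers \<open>rho \<Lambda> i\<close> as eigenvalues. Uniqueness: proportionality together with
  the normalization of the sum.\<close>

lemma pf_vec_properties:
  assumes fin: "finite_kgraph k \<Lambda>" and sc: "strongly_connected \<Lambda>" and ne: "verts \<Lambda> \<noteq> {}"
  shows pf_vec_pos: "v \<in> verts \<Lambda> \<Longrightarrow> 0 < pf_vec k \<Lambda> v"
    and pf_vec_sum: "(\<Sum>v\<in>verts \<Lambda>. pf_vec k \<Lambda> v) = 1"
    and pf_vec_eigen: "i \<in> {1..k} \<Longrightarrow> v \<in> verts \<Lambda> \<Longrightarrow>
      (\<Sum>w\<in>verts \<Lambda>. real (adj \<Lambda> i v w) * pf_vec k \<Lambda> w) = rho \<Lambda> i * pf_vec k \<Lambda> v"
proof -
  let ?V = "verts \<Lambda>"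
  let ?A = "\<lambda>i v w. real (adj \<Lambda> i v w)"
  let ?B = "\<lambda>v w. \<Sum>i\<in>{1..k}. ?A i v w"
  have finV: "finite ?V" by (rule finite_verts[OF fin])
  have irr: "irreducible_mat ?V ?B" by (rule irreducible_adj_sum[OF fin sc])
  define P where "P = (\<lambda>x. (\<forall>v. v \<notin> ?V \<longrightarrow> x v = 0) \<and> (\<forall>v\<in>?V. x v > 0) \<and> sum x ?V = 1 \<and>
     (\<forall>i\<in>{1..k}. \<forall>v\<in>?V. (\<Sum>w\<in>?V. ?A i v w * x w) = rho \<Lambda> i * x v))"
  have comm: "(\<Sum>u\<in>?V. ?A i v u * ?A j u w) = (\<Sum>u\<in>?V. ?A j v u * ?A i u w)"
    if "i \<in> {1..k}" "j \<in> {1..k}" for i j v w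
    using arg_cong[OF adj_commute[OF fin that, of v w], of real] by simp
  obtain x l where x: "\<And>v. v \<in> ?V \<Longrightarrow> 0 < x v" "sum x ?V = 1"
    "\<And>i v. i \<in> {1..k} \<Longrightarrow> v \<in> ?V \<Longrightarrow> mat_app ?V (?A i) x v = l i * x v"
    using commuting_common_positive_eigenvector[OF finV ne _ comm irr] by auto
  have "rho \<Lambda> i = l i" if "i \<in> {1..k}" for i
    by (rule rho_eq_positive_eigenvalue[OF fin ne x(1) x(3)[OF that]])
  then have P0: "P (\<lambda>v. if v \<in> ?V then x v else 0)"
    using x by (auto simp: P_def mat_app_def cong: sum.cong)
  have uniq: "y = z" if y: "P y" and z: "P z" for y z
  proof -
    \<comment> \<open>Any two candidates are eigenvectors of the summed matrix for the same
      eigenvalue, the sum of all \<open>rho \<Lambda> i\<close>, so the proportionality lemma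
      applies to them.\<close>
    have eig: "mat_app ?V ?B u v = (\<Sum>i\<in>{1..k}. rho \<Lambda> i) * u v" if "P u" "v \<in> ?V" for u v
    proof -
      have "mat_app ?V ?B u v = (\<Sum>i\<in>{1..k}. \<Sum>w\<in>?V. ?A i v w * u w)"
        unfolding mat_app_def sum_distrib_right by (rule sum.swap)
      then show ?thesis using that by (simp add: P_def sum_distrib_right)
    qed
    have nnB: "0 \<le> ?B v w" for v w by (intro sum_nonneg) simp
    have y0: "\<And>v. v \<in> ?V \<Longrightarrow> 0 < y v" using y by (simp add: P_def)
    obtain c where c: "\<And>v. v \<in> ?V \<Longrightarrow> z v = c * y v"
      using irreducible_eigenvector_proportional[OF finV ne nnB irr y0 eig[OF y] eig[OF z]]
      by blast
    have "sum z ?V = c * sum y ?V" using c by (simp add: sum_distrib_left)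
    then have "c = 1" using y z by (simp add: P_def)
    show ?thesis
    proof
      fix v show "y v = z v"
        using c[of v] \<open>c = 1\<close> y z by (cases "v \<in> ?V") (auto simp: P_def)
    qed
  qed
  have "P (THE x. P x)"
    by (rule theI[of P, OF P0]) (rule uniq[OF _ P0])
  then have pf: "P (pf_vec k \<Lambda>)" by (simp add: pf_vec_def P_def)
  show "v \<in> ?V \<Longrightarrow> 0 < pf_vec k \<Lambda> v" "sum (pf_vec k \<Lambda>) ?V = 1"
    "i \<in> {1..k} \<Longrightarrow> v \<in> ?V \<Longrightarrow>
      (\<Sum>w\<in>?V. real (adj \<Lambda> i v w) * pf_vec k \<Lambda> w) = rho \<Lambda> i * pf_vec k \<Lambda> v"
    using pf unfolding P_def by auto
qed

end

section \<open>Counting paths in the Bratteli diagram\<close>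

definition paths_from :: "nat \<Rightarrow> 'm kgraph \<Rightarrow> 'm \<Rightarrow> nat \<Rightarrow> 'm bpath set" where
  "paths_from k \<Lambda> v n = {\<eta> \<in> fin_paths k \<Lambda>. fst \<eta> = (0, v) \<and> path_len \<eta> = n}"

text \<open>The base of the power in \<open>weight\<close>, arranged by levels so that one more edge
  means one more factor; \<open>rho_prod_eq_weight_product\<close> recovers the arrangement by
  colours.\<close>

definition rho_prod :: "nat \<Rightarrow> 'm kgraph \<Rightarrow> nat \<Rightarrow> real" where
  "rho_prod k \<Lambda> n = (\<Prod>j<n. rho \<Lambda> (level_color k (Suc j)))"

section \<open>Products of spectral radii along the levels\<close>

lemma level_color_range: "k \<ge> 1 \<Longrightarrow> level_color k n \<in> {1..k}"
  by (simp add: level_color_def Suc_leI)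

lemma rho_prod_Suc: "rho_prod k \<Lambda> (Suc n) = rho_prod k \<Lambda> n * rho \<Lambda> (level_color k (Suc n))"
  by (simp add: rho_prod_def)

text \<open>Level colours repeat with period \<open>k\<close>, so each full period contributes the
  same factor \<open>rho_prod k \<Lambda> k\<close>.\<close>

lemma rho_prod_add_mult: "rho_prod k \<Lambda> (q * k + n) = rho_prod k \<Lambda> k ^ q * rho_prod k \<Lambda> n"
proof (induction q)
  case 0
  then show ?case by simp
next
  case (Suc q)
  have per: "rho_prod k \<Lambda> (k + m) = rho_prod k \<Lambda> k * rho_prod k \<Lambda> m" for m
    by (induction m) (simp_all add: rho_prod_def level_color_def)
  have "rho_prod k \<Lambda> (Suc q * k + n) = rho_prod k \<Lambda> (k + (q * k + n))"
    by (simp add: algebra_simps)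
  then show ?case using Suc.IH per by simp
qed

text \<open>One more level raises the exponent of colour \<open>t + 1\<close> and so moves it from
  the second product into the first. When \<open>t + 1 = k\<close> the first product is complete and
  becomes the second product for the next quotient.\<close>

lemma rho_prod_eq_weight_product:
  assumes "k \<ge> 1"
  shows "rho_prod k \<Lambda> n =
    (\<Prod>i\<in>{1..n mod k}. rho \<Lambda> i ^ (n div k + 1)) * (\<Prod>i\<in>{n mod k + 1..k}. rho \<Lambda> i ^ (n div k))"
proof (induction n)
  case 0
  then show ?case by (simp add: rho_prod_def)
next
  case (Suc n)
  let ?W = "\<lambda>q t. (\<Prod>i\<in>{1..t}. rho \<Lambda> i ^ (q + 1)) * (\<Prod>i\<in>{t + 1..k}. rho \<Lambda> i ^ q)"
  define q where "q = n div k"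
  define t where "t = n mod k"
  have t: "t < k" using assms by (simp add: t_def)
  have "{t + 1..k} = insert (t + 1) {Suc t + 1..k}" using t by auto
  then have step: "?W q t * rho \<Lambda> (t + 1) = ?W q (Suc t)"
    by (simp add: atLeastAtMostSuc_conv mult_ac)
  have "?W q (Suc t) = ?W (Suc n div k) (Suc n mod k)"
  proof (cases "Suc t = k")
    case True
    then have "Suc n div k = Suc q" "Suc n mod k = 0"
      by (auto simp: q_def t_def div_Suc mod_Suc)
    then show ?thesis using True by simp
  next
    case False
    then have "Suc n div k = q" "Suc n mod k = Suc t"
      using t by (auto simp: q_def t_def div_Suc mod_Suc)
    then show ?thesis by simp
  qed
  then show ?case
    using Suc.IH step by (simp add: rho_prod_Suc level_color_def q_def t_def)
qed

lemma weight_eq: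
  assumes "k \<ge> 1"
  shows "weight k \<Lambda> \<delta> \<eta> =
    rho_prod k \<Lambda> (path_len \<eta>) powr (- 1 / \<delta>) * pf_vec k \<Lambda> (snd (path_src \<eta>))"
  by (simp only: weight_def Let_def rho_prod_eq_weight_product[OF assms])

section \<open>Extending finite paths by one edge\<close>

lemma paths_from_0: "paths_from k \<Lambda> v 0 = (if v \<in> verts \<Lambda> then {((0, v), [])} else {})"
  by (auto simp: paths_from_def fin_paths_def path_len_def bverts_def)

lemma path_src_paths_from:
  assumes "\<eta> \<in> paths_from k \<Lambda> v n"
  shows "path_src \<eta> = (n, snd (path_src \<eta>))" "snd (path_src \<eta>) \<in> verts \<Lambda>"
proof -
  have "path_src \<eta> = (n, snd (path_src \<eta>)) \<and> snd (path_src \<eta>) \<in> verts \<Lambda>"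
  proof (cases "snd \<eta> = []")
    case True
    then show ?thesis
      using assms by (auto simp: paths_from_def fin_paths_def path_len_def bverts_def path_src_def)
  next
    case False
    then have n: "n > 0" "last (snd \<eta>) = snd \<eta> ! (n - 1)"
      using assms by (auto simp: paths_from_def path_len_def last_conv_nth)
    have "\<forall>j<n. snd \<eta> ! j \<in> bedges k \<Lambda> (Suc j)"
      using assms by (auto simp: paths_from_def fin_paths_def path_len_def)
    then have "last (snd \<eta>) \<in> bedges k \<Lambda> n" using n by (auto dest: spec[of _ "n - 1"])
    then obtain p q j where "last (snd \<eta>) = (n, p, q, j)" "q \<in> verts \<Lambda>"
      by (auto simp: bedges_def)
    then show ?thesis using False by (simp add: path_src_def)
  qed
  then show "path_src \<eta> = (n, snd (path_src \<eta>))" "snd (path_src \<eta>) \<in> verts \<Lambda>" by auto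
qed

text \<open>Level and range of the new edge are forced by \<open>\<eta>\<close>; only its source and
  its index among parallel edges are free.\<close>

definition path_snoc :: "'m bpath \<Rightarrow> 'm \<times> nat \<Rightarrow> 'm bpath" where
  "path_snoc \<eta> qj = (fst \<eta>, snd \<eta> @ [(Suc (path_len \<eta>), snd (path_src \<eta>), qj)])"

lemma path_src_snoc: "snd (path_src (path_snoc \<eta> qj)) = fst qj"
  by (cases qj) (simp add: path_snoc_def path_src_def)

lemma path_snoc_in_paths_from:
  assumes \<eta>: "\<eta> \<in> paths_from k \<Lambda> v n" and q: "q \<in> verts \<Lambda>"
    and j: "j < adj \<Lambda> (level_color k (Suc n)) (snd (path_src \<eta>)) q"
  shows "path_snoc \<eta> (q, j) \<in> paths_from k \<Lambda> v (Suc n)"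
proof -
  obtain es where es: "\<eta> = ((0, v), es)" "length es = n"
    using \<eta> by (cases \<eta>) (auto simp: paths_from_def path_len_def)
  define p where "p = snd (path_src \<eta>)"
  define e where "e = (Suc n, p, q, j)"
  have src: "path_src \<eta> = (n, p)" and p: "p \<in> verts \<Lambda>"
    using path_src_paths_from[OF \<eta>] by (simp_all add: p_def)
  have e: "e \<in> bedges k \<Lambda> (Suc n)" using p q j by (simp add: e_def bedges_def p_def)
  have fin: "(0, v) \<in> bverts \<Lambda> 0" "\<And>i. i < n \<Longrightarrow> es ! i \<in> bedges k \<Lambda> (Suc i)"
    "es \<noteq> [] \<Longrightarrow> brng (es ! 0) = (0, v)" "\<And>i. Suc i < n \<Longrightarrow> bsrc (es ! i) = brng (es ! Suc i)"
    using \<eta> es by (auto simp: paths_from_def fin_paths_def)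
  have link: "bsrc (es ! i) = (n, p)" if "Suc i = n" for i
  proof -
    have ne: "es \<noteq> []" using es(2) that by auto
    then have "last es = es ! i" using es(2) that by (metis last_conv_nth diff_Suc_1)
    then show ?thesis using src es(1) ne by (simp add: path_src_def)
  qed
  \<comment> \<open>For the empty path the new edge is the first one, so its range has to be the
    starting vertex.\<close>
  have start: "es = [] \<Longrightarrow> p = v" using src es by (simp add: path_src_def)
  have "((0, v), es @ [e]) \<in> paths_from k \<Lambda> v (Suc n)"
    unfolding paths_from_def fin_paths_def path_len_def mem_Collect_eq prod.case fst_conv snd_conv
  proof (intro conjI allI impI)
    fix i assume "i < length (es @ [e])"
    then show "(es @ [e]) ! i \<in> bedges k \<Lambda> (Suc i)"
      using fin(2) e es(2) by (auto simp: nth_append less_Suc_eq)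
  next
    fix i assume "Suc i < length (es @ [e])"
    then show "bsrc ((es @ [e]) ! i) = brng ((es @ [e]) ! Suc i)"
      using fin(4) link es(2) by (auto simp: nth_append e_def less_Suc_eq)
  next
    show "brng ((es @ [e]) ! 0) = (0, v)"
      using fin(3) start es(2) by (cases "es = []") (auto simp: nth_append e_def)
  qed (use fin(1) es(2) in auto)
  then show ?thesis
    using es by (simp add: path_snoc_def path_len_def e_def p_def)
qed

text \<open>The inverse removes the last edge. This is the recursion in the length on which
  finiteness and the eigenvector sums rest.\<close>

lemma paths_from_Suc:
  "bij_betw (\<lambda>(\<eta>, qj). path_snoc \<eta> qj)
     (SIGMA \<eta>:paths_from k \<Lambda> v n. SIGMA q:verts \<Lambda>.
        {..<adj \<Lambda> (level_color k (Suc n)) (snd (path_src \<eta>)) q})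
     (paths_from k \<Lambda> v (Suc n))"
  (is "bij_betw ?f ?S ?T")
  unfolding bij_betw_def
proof (intro conjI equalityI subsetI)
  show "inj_on ?f ?S"
    by (rule inj_onI) (auto simp: path_snoc_def prod_eq_iff)
  show "\<eta> \<in> ?T" if "\<eta> \<in> ?f ` ?S" for \<eta>
    using that path_snoc_in_paths_from by fastforce
  fix \<theta> assume \<theta>: "\<theta> \<in> ?T"
  then obtain es e where es: "\<theta> = ((0, v), es @ [e])" "length es = n"
    by (cases \<theta>; cases "snd \<theta>" rule: rev_cases) (auto simp: paths_from_def path_len_def)
  have fin: "(0, v) \<in> bverts \<Lambda> 0" "\<And>i. i < Suc n \<Longrightarrow> (es @ [e]) ! i \<in> bedges k \<Lambda> (Suc i)"
    "brng ((es @ [e]) ! 0) = (0, v)"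
    "\<And>i. Suc i < Suc n \<Longrightarrow> bsrc ((es @ [e]) ! i) = brng ((es @ [e]) ! Suc i)"
    using \<theta> es by (auto simp: paths_from_def fin_paths_def)
  let ?\<eta> = "((0, v), es)"
  have \<eta>: "?\<eta> \<in> paths_from k \<Lambda> v n"
    unfolding paths_from_def fin_paths_def path_len_def mem_Collect_eq prod.case fst_conv snd_conv
  proof (intro conjI allI impI)
    fix i assume "i < length es"
    then show "es ! i \<in> bedges k \<Lambda> (Suc i)" using fin(2)[of i] es(2) by (simp add: nth_append)
  next
    fix i assume "Suc i < length es"
    then show "bsrc (es ! i) = brng (es ! Suc i)" using fin(4)[of i] es(2) by (simp add: nth_append)
  next
    assume "es \<noteq> []"
    then show "brng (es ! 0) = (0, v)" using fin(3) by (simp add: nth_append)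
  qed (use fin(1) es(2) in auto)
  have "e \<in> bedges k \<Lambda> (Suc n)" using fin(2)[of n] es(2) by (simp add: nth_append)
  then obtain p q j where e: "e = (Suc n, p, q, j)" "q \<in> verts \<Lambda>"
    "j < adj \<Lambda> (level_color k (Suc n)) p q"
    by (auto simp: bedges_def)
  have p: "snd (path_src ?\<eta>) = p"
  proof (cases "es = []")
    case True
    then show ?thesis using fin(3) e es(2) by (simp add: path_src_def)
  next
    case False
    then have "Suc (n - 1) = n" "last es = es ! (n - 1)" using es(2) by (auto simp: last_conv_nth)
    then have "bsrc (last es) = brng e"
      using fin(4)[of "n - 1"] es(2) by (simp add: nth_append)
    then show ?thesis using False e by (simp add: path_src_def)
  qed
  have "\<theta> = ?f (?\<eta>, (q, j))"
    using es e p by (simp add: path_snoc_def path_len_def)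
  moreover have "(?\<eta>, (q, j)) \<in> ?S" using \<eta> e p by simp
  ultimately show "\<theta> \<in> ?f ` ?S" by blast
qed

lemma finite_paths_from:
  assumes "finite (verts \<Lambda>)"
  shows "finite (paths_from k \<Lambda> v n)"
proof (induction n)
  case 0
  then show ?case by (simp add: paths_from_0)
next
  case (Suc n)
  then show ?case
    using bij_betw_finite[OF paths_from_Suc[of k \<Lambda> v n]] assms by auto
qed

section \<open>Eigenvector sums over paths of fixed length\<close>

text \<open>Summing \<open>x\<close> over the sources of all one-edge extensions of
  \<open>\<eta>\<close> applies the vertex matrix of the next colour at the source of
  \<open>\<eta>\<close>, which by the eigenvector equation multiplies the contribution of
  \<open>\<eta>\<close> by \<open>rho\<close>.\<close>

lemma sum_path_src_eigenvector:
  assumes k: "k \<ge> 1" and fin: "finite (verts \<Lambda>)" and v: "v \<in> verts \<Lambda>"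
    and eig: "\<And>i v. i \<in> {1..k} \<Longrightarrow> v \<in> verts \<Lambda> \<Longrightarrow>
      (\<Sum>w\<in>verts \<Lambda>. real (adj \<Lambda> i v w) * x w) = rho \<Lambda> i * x v"
  shows "(\<Sum>\<eta>\<in>paths_from k \<Lambda> v n. x (snd (path_src \<eta>))) = rho_prod k \<Lambda> n * x v"
proof (induction n)
  case 0
  then show ?case using v by (simp add: paths_from_0 path_src_def rho_prod_def)
next
  case (Suc n)
  let ?c = "level_color k (Suc n)"
  let ?E = "\<lambda>\<eta>. SIGMA q:verts \<Lambda>. {..<adj \<Lambda> ?c (snd (path_src \<eta>)) q}"
  have "(\<Sum>\<eta>\<in>paths_from k \<Lambda> v (Suc n). x (snd (path_src \<eta>))) =
      (\<Sum>(\<eta>, qj)\<in>(SIGMA \<eta>:paths_from k \<Lambda> v n. ?E \<eta>). x (fst qj))"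
    by (subst sum.reindex_bij_betw[OF paths_from_Suc, symmetric])
       (simp add: case_prod_unfold path_src_snoc)
  also have "\<dots> = (\<Sum>\<eta>\<in>paths_from k \<Lambda> v n. \<Sum>qj\<in>?E \<eta>. x (fst qj))"
    using finite_paths_from[OF fin] fin by (subst sum.Sigma) auto
  also have "\<dots> = (\<Sum>\<eta>\<in>paths_from k \<Lambda> v n. rho \<Lambda> ?c * x (snd (path_src \<eta>)))"
  proof (rule sum.cong[OF refl])
    fix \<eta> assume \<eta>: "\<eta> \<in> paths_from k \<Lambda> v n"
    have "(\<Sum>qj\<in>?E \<eta>. x (fst qj)) =
        (\<Sum>q\<in>verts \<Lambda>. \<Sum>j<adj \<Lambda> ?c (snd (path_src \<eta>)) q. x q)"
      using fin by (subst sum.Sigma) (auto simp: case_prod_unfold)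
    also have "\<dots> = rho \<Lambda> ?c * x (snd (path_src \<eta>))"
      using eig[OF level_color_range[OF k] path_src_paths_from(2)[OF \<eta>]] by simp
    finally show "(\<Sum>qj\<in>?E \<eta>. x (fst qj)) = rho \<Lambda> ?c * x (snd (path_src \<eta>))" .
  qed
  also have "\<dots> = rho_prod k \<Lambda> (Suc n) * x v"
    using Suc.IH by (simp add: rho_prod_Suc flip: sum_distrib_left)
  finally show ?case .
qed

lemma fin_paths_eq_UN_paths_from:
  "{\<eta> \<in> fin_paths k \<Lambda>. path_len \<eta> = n} = (\<Union>v\<in>verts \<Lambda>. paths_from k \<Lambda> v n)"
  by (auto simp: paths_from_def fin_paths_def bverts_def)

lemma finite_fin_paths_len:
  "finite (verts \<Lambda>) \<Longrightarrow> finite {\<eta> \<in> fin_paths k \<Lambda>. path_len \<eta> = n}"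
  by (simp add: fin_paths_eq_UN_paths_from finite_paths_from)

lemma sum_fin_paths_len_eigenvector:
  assumes k: "k \<ge> 1" and fin: "finite (verts \<Lambda>)"
    and eig: "\<And>i v. i \<in> {1..k} \<Longrightarrow> v \<in> verts \<Lambda> \<Longrightarrow>
      (\<Sum>w\<in>verts \<Lambda>. real (adj \<Lambda> i v w) * x w) = rho \<Lambda> i * x v"
  shows "(\<Sum>\<eta>\<in>{\<eta> \<in> fin_paths k \<Lambda>. path_len \<eta> = n}. x (snd (path_src \<eta>))) =
    rho_prod k \<Lambda> n * sum x (verts \<Lambda>)"
proof -
  have "(\<Sum>\<eta>\<in>{\<eta> \<in> fin_paths k \<Lambda>. path_len \<eta> = n}. x (snd (path_src \<eta>))) =
      (\<Sum>v\<in>verts \<Lambda>. \<Sum>\<eta>\<in>paths_from k \<Lambda> v n. x (snd (path_src \<eta>)))"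
    unfolding fin_paths_eq_UN_paths_from using fin finite_paths_from[OF fin]
    by (intro sum.UNION_disjoint) (auto simp: paths_from_def)
  also have "\<dots> = rho_prod k \<Lambda> n * sum x (verts \<Lambda>)"
    using sum_path_src_eigenvector[OF k fin _ eig] by (simp add: sum_distrib_left)
  finally show ?thesis .
qed

section \<open>Growth forced by infinite paths\<close>

text \<open>An infinite path uses every colour, so the matrix of colour \<open>i\<close> has a
  positive entry; the eigenvector equation in that row gives the sign of
  \<open>rho \<Lambda> i\<close>.\<close>

lemma rho_pos_of_inf_path:
  assumes y: "y \<in> inf_paths k \<Lambda>" and fin: "finite (verts \<Lambda>)" and i: "i \<in> {1..k}"
    and pos: "\<And>v. v \<in> verts \<Lambda> \<Longrightarrow> 0 < x v"
    and eig: "\<And>v. v \<in> verts \<Lambda> \<Longrightarrow>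
      (\<Sum>w\<in>verts \<Lambda>. real (adj \<Lambda> i v w) * x w) = rho \<Lambda> i * x v"
  shows "0 < rho \<Lambda> i"
proof -
  \<comment> \<open>Entries are indexed from 0, so \<open>y (i - 1)\<close> is the edge in level
    \<open>i\<close>, whose colour is \<open>i\<close>.\<close>
  have "y (i - 1) \<in> bedges k \<Lambda> (Suc (i - 1))" using y by (auto simp: inf_paths_def)
  moreover have "level_color k (Suc (i - 1)) = i" using i by (auto simp: level_color_def)
  ultimately obtain p q where pq: "p \<in> verts \<Lambda>" "q \<in> verts \<Lambda>" "0 < adj \<Lambda> i p q"
    by (auto simp: bedges_def)
  have "0 < (\<Sum>w\<in>verts \<Lambda>. real (adj \<Lambda> i p w) * x w)"
    using fin pq pos by (intro sum_pos2[of _ q]) (auto simp: less_imp_le)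
  then show ?thesis
    using eig[OF pq(1)] pos[OF pq(1)] by (simp add: zero_less_mult_iff)
qed

lemma init_seg_in_paths_from:
  assumes "x \<in> inf_paths k \<Lambda>" "brng (x 0) = (0, v)" "v \<in> verts \<Lambda>"
  shows "init_seg x n \<in> paths_from k \<Lambda> v n"
  using assms
  by (auto simp: init_seg_def paths_from_def fin_paths_def inf_paths_def path_len_def bverts_def)

text \<open>Were \<open>\<rho>\<^sub>1 \<cdots> \<rho>\<^sub>k \<le> 1\<close>, the two paths would have initial segments whose sources together
  weigh at least twice the minimum \<open>x\<^sub>v\<close>, while all segments of that length together weigh at
  most \<open>x\<^sub>v\<close>.\<close>

lemma rho_prod_gt_1:
  assumes k: "k \<ge> 1" and fin: "finite (verts \<Lambda>)" and v: "v \<in> verts \<Lambda>"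
    and pos: "\<And>w. w \<in> verts \<Lambda> \<Longrightarrow> 0 < x w"
    and min: "\<And>w. w \<in> verts \<Lambda> \<Longrightarrow> x v \<le> x w"
    and eig: "\<And>i v. i \<in> {1..k} \<Longrightarrow> v \<in> verts \<Lambda> \<Longrightarrow>
      (\<Sum>w\<in>verts \<Lambda>. real (adj \<Lambda> i v w) * x w) = rho \<Lambda> i * x v"
    and y: "y \<in> inf_paths k \<Lambda>" "brng (y 0) = (0, v)"
    and z: "z \<in> inf_paths k \<Lambda>" "brng (z 0) = (0, v)" and yz: "y \<noteq> z"
  shows "1 < rho_prod k \<Lambda> k"
proof (rule ccontr)
  assume "\<not> 1 < rho_prod k \<Lambda> k"
  moreover have "0 < rho \<Lambda> i" if "i \<in> {1..k}" for i
    by (rule rho_pos_of_inf_path[OF y(1) fin that pos eig[OF that]])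
  then have "0 \<le> rho_prod k \<Lambda> k"
    unfolding rho_prod_def using level_color_range[OF k] by (intro prod_nonneg less_imp_le) auto
  ultimately have le: "rho_prod k \<Lambda> k ^ m \<le> 1" for m by (simp add: power_le_one)
  obtain m where m: "y m \<noteq> z m" using yz by blast
  \<comment> \<open>A multiple of \<open>k\<close>, so that the product over \<open>n\<close> levels
    is a power of \<open>rho_prod k \<Lambda> k\<close>, and larger than \<open>m\<close>, so that
    segments of length \<open>n\<close> include the position where the paths differ.\<close>
  define n where "n = Suc m * k"
  have "m < n" using k unfolding n_def
    by (metis Suc_le_lessD Suc_le_eq mult.right_neutral mult_le_mono2)
  have ne: "init_seg y n \<noteq> init_seg z n"
    using m \<open>m < n\<close> by (auto simp: init_seg_def)
  have sub: "{init_seg y n, init_seg z n} \<subseteq> paths_from k \<Lambda> v n"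
    using init_seg_in_paths_from[OF y v] init_seg_in_paths_from[OF z v] by simp
  let ?g = "\<lambda>\<eta>. x (snd (path_src \<eta>))"
  have gmin: "x v \<le> ?g \<eta>" if "\<eta> \<in> paths_from k \<Lambda> v n" for \<eta>
    using min path_src_paths_from(2)[OF that] by blast
  have "2 * x v \<le> ?g (init_seg y n) + ?g (init_seg z n)"
    using gmin[of "init_seg y n"] gmin[of "init_seg z n"] sub by simp
  also have "\<dots> = sum ?g {init_seg y n, init_seg z n}" using ne by simp
  also have "\<dots> \<le> sum ?g (paths_from k \<Lambda> v n)"
  proof (rule sum_mono2[OF finite_paths_from[OF fin] sub])
    fix \<eta> assume "\<eta> \<in> paths_from k \<Lambda> v n - {init_seg y n, init_seg z n}"
    then have "\<eta> \<in> paths_from k \<Lambda> v n" by simp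
    from pos[OF path_src_paths_from(2)[OF this]] show "0 \<le> ?g \<eta>" by simp
  qed
  also have "\<dots> = rho_prod k \<Lambda> k ^ Suc m * x v"
    using sum_path_src_eigenvector[OF k fin v eig, of n] rho_prod_add_mult[of k \<Lambda> "Suc m" 0]
    by (simp add: n_def rho_prod_def)
  also have "\<dots> \<le> 1 * x v"
    using le[of "Suc m"] pos[OF v] by (intro mult_right_mono) (simp_all only: less_imp_le)
  finally show False using pos[OF v] by simp
qed

section \<open>Convergence of the zeta function\<close>

text \<open>The positive ratio of \<open>x v powr s\<close> to \<open>x v\<close> takes finitely
  many values, whatever the sign of \<open>s\<close>. This replaces the powers in the zeta function
  by entries of \<open>x\<close>, whose sums over paths are known.\<close>

lemma powr_comparable_on_finite:
  fixes x :: "'a \<Rightarrow> real"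
  assumes fin: "finite V" and ne: "V \<noteq> {}" and pos: "\<And>v. v \<in> V \<Longrightarrow> 0 < x v"
  obtains c C where "0 < c" "0 < C" "\<And>v. v \<in> V \<Longrightarrow> c * x v \<le> x v powr s"
    "\<And>v. v \<in> V \<Longrightarrow> x v powr s \<le> C * x v"
proof -
  let ?r = "\<lambda>v. x v powr s / x v"
  define c where "c = Min (?r ` V)"
  define C where "C = Max (?r ` V)"
  have r: "0 < ?r v" if "v \<in> V" for v using pos[OF that] by simp
  have c: "0 < c" unfolding c_def using fin ne r by (subst Min_gr_iff) auto
  have cC: "c \<le> ?r v" "?r v \<le> C" if "v \<in> V" for v
    unfolding c_def C_def using fin that by auto
  obtain v where "v \<in> V" using ne by blast
  then have "0 < C" using c cC[of v] by linarith
  moreover have "c * x v \<le> x v powr s" "x v powr s \<le> C * x v" if "v \<in> V" for v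
    using cC[OF that] pos[OF that] by (simp_all add: field_simps)
  ultimately show ?thesis using c that by blast
qed

text \<open>An infinite sum of nonnegative extended reals is the supremum of its finite partial
  sums; this lemma and the next thereby reduce finiteness to bounds on real sums.\<close>

lemma infsum_ennreal_finite_of_bounded:
  fixes f :: "'a \<Rightarrow> real"
  assumes "\<And>a. a \<in> A \<Longrightarrow> 0 \<le> f a" and "\<And>F. finite F \<Longrightarrow> F \<subseteq> A \<Longrightarrow> sum f F \<le> M"
  shows "(\<Sum>\<^sub>\<infinity>a\<in>A. ennreal (f a)) < \<infinity>"
proof -
  have "(\<Sum>\<^sub>\<infinity>a\<in>A. ennreal (f a)) = (SUP F\<in>{F. finite F \<and> F \<subseteq> A}. \<Sum>a\<in>F. ennreal (f a))"
    by (rule nonneg_infsum_complete) simp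
  also have "\<dots> \<le> ennreal M"
  proof (rule SUP_least)
    fix F assume "F \<in> {F. finite F \<and> F \<subseteq> A}"
    then have F: "finite F" "F \<subseteq> A" by auto
    then have "(\<Sum>a\<in>F. ennreal (f a)) = ennreal (sum f F)"
      using assms(1) by (intro sum_ennreal) auto
    then show "(\<Sum>a\<in>F. ennreal (f a)) \<le> ennreal M"
      using assms(2)[OF F] by (simp add: ennreal_leI)
  qed
  also have "\<dots> < \<infinity>" by simp
  finally show ?thesis .
qed

lemma infsum_ennreal_infinite_of_unbounded:
  fixes f :: "'a \<Rightarrow> real"
  assumes nn: "\<And>a. a \<in> A \<Longrightarrow> 0 \<le> f a"
    and unb: "\<And>M. \<exists>F. finite F \<and> F \<subseteq> A \<and> M < sum f F"
  shows "(\<Sum>\<^sub>\<infinity>a\<in>A. ennreal (f a)) = \<infinity>"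
proof (rule ccontr)
  let ?S = "\<Sum>\<^sub>\<infinity>a\<in>A. ennreal (f a)"
  assume "?S \<noteq> \<infinity>"
  then obtain r where r: "?S = ennreal r" "0 \<le> r" by (cases ?S) auto
  obtain F where F: "finite F" "F \<subseteq> A" "r < sum f F" using unb by blast
  have "ennreal (sum f F) = (\<Sum>a\<in>F. ennreal (f a))"
    using nn F by (intro sum_ennreal[symmetric]) auto
  also have "\<dots> \<le> (SUP F\<in>{F. finite F \<and> F \<subseteq> A}. \<Sum>a\<in>F. ennreal (f a))"
    using F by (intro SUP_upper) auto
  also have "\<dots> = ?S"
    by (rule nonneg_infsum_complete[symmetric]) simp
  finally show False using r F(3) by simp
qed

lemma sum_le_sum_by_length:
  fixes f :: "'m bpath \<Rightarrow> real"
  assumes fin: "finite (verts \<Lambda>)" and nn: "\<And>\<eta>. 0 \<le> f \<eta>"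
    and F: "finite F" "F \<subseteq> fin_paths k \<Lambda>" "\<And>\<eta>. \<eta> \<in> F \<Longrightarrow> path_len \<eta> < n"
  shows "sum f F \<le> (\<Sum>m<n. sum f {\<eta> \<in> fin_paths k \<Lambda>. path_len \<eta> = m})"
proof -
  have "sum f F = (\<Sum>m<n. sum f {\<eta> \<in> F. path_len \<eta> = m})"
    by (rule sum.group[symmetric]) (use F in auto)
  also have "\<dots> \<le> (\<Sum>m<n. sum f {\<eta> \<in> fin_paths k \<Lambda>. path_len \<eta> = m})"
    by (intro sum_mono sum_mono2 finite_fin_paths_len fin nn) (use F in auto)
  finally show ?thesis .
qed

text \<open>A path has distance 0 from itself, so a positive supremum must come from two distinct
  paths.\<close>

lemma two_paths_of_cyl_diam_pos:
  assumes "0 < cyl_diam k \<Lambda> \<delta> ((0, v), [])"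
  obtains y z where "y \<in> inf_paths k \<Lambda>" "brng (y 0) = (0, v)" "z \<in> inf_paths k \<Lambda>"
    "brng (z 0) = (0, v)" "y \<noteq> z"
proof -
  obtain y z where yz: "y \<in> cyl k \<Lambda> ((0, v), [])" "z \<in> cyl k \<Lambda> ((0, v), [])"
    "0 < ennreal (path_dist k \<Lambda> \<delta> y z)"
    using assms unfolding cyl_diam_def less_Sup_iff by blast
  then have "y \<noteq> z" by (auto simp: path_dist_def)
  then show ?thesis
    using that[of y z] yz(1,2) by (simp add: cyl_def init_seg_def)
qed

section \<open>Comparison of the zeta function with a geometric series\<close>

theorem theorem3p8:
  fixes \<Lambda> :: "'m kgraph" and k :: nat and \<delta> s :: real
  assumes "k \<ge> 1"
    and "k_graph k \<Lambda>"
    and "finite_kgraph k \<Lambda>"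
    and "strongly_connected \<Lambda>"
    and "verts \<Lambda> \<noteq> {}"
    and "0 < \<delta>" and "\<delta> < 1"
    and "\<forall>\<eta>\<in>fin_paths k \<Lambda>. ennreal (weight k \<Lambda> \<delta> \<eta>) = cyl_diam k \<Lambda> \<delta> \<eta>"
  shows "zeta k \<Lambda> \<delta> s < \<infinity> \<longleftrightarrow> s > \<delta>"
proof -
  note k = assms(1) and ne = assms(5) and \<delta> = assms(6)
  define x where "x = pf_vec k \<Lambda>"
  define R where "R = rho_prod k \<Lambda>"
  define L where "L n = {\<eta> \<in> fin_paths k \<Lambda>. path_len \<eta> = n}" for n
  define f where "f \<eta> = weight k \<Lambda> \<delta> \<eta> powr s" for \<eta>
  have fin: "finite (verts \<Lambda>)" by (rule finite_verts[OF assms(2,3)])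
  have pos: "\<And>v. v \<in> verts \<Lambda> \<Longrightarrow> 0 < x v" and sum1: "sum x (verts \<Lambda>) = 1"
    and eig: "\<And>i v. i \<in> {1..k} \<Longrightarrow> v \<in> verts \<Lambda> \<Longrightarrow>
      (\<Sum>w\<in>verts \<Lambda>. real (adj \<Lambda> i v w) * x w) = rho \<Lambda> i * x v"
    unfolding x_def using pf_vec_properties[OF assms(2-5)] by auto
  have "Min (x ` verts \<Lambda>) \<in> x ` verts \<Lambda>" using fin ne by (intro Min_in) auto
  then obtain v where v: "v \<in> verts \<Lambda>" "x v = Min (x ` verts \<Lambda>)" by auto
  have vmin: "\<And>w. w \<in> verts \<Lambda> \<Longrightarrow> x v \<le> x w" using v(2) fin by simp
  have "((0, v), []) \<in> fin_paths k \<Lambda>" using v(1) by (simp add: fin_paths_def bverts_def)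
  \<comment> \<open>At length 0 the product of spectral radii is empty, so the weight is
    \<open>x v\<close> itself.\<close>
  moreover have "0 < weight k \<Lambda> \<delta> ((0, v), [])"
    using pos[OF v(1)] by (simp add: weight_eq[OF k] path_len_def path_src_def rho_prod_def x_def)
  ultimately have "0 < cyl_diam k \<Lambda> \<delta> ((0, v), [])"
    using assms(8) by (metis ennreal_less_zero_iff)
  then obtain y z where yz: "y \<in> inf_paths k \<Lambda>" "brng (y 0) = (0, v)" "z \<in> inf_paths k \<Lambda>"
    "brng (z 0) = (0, v)" "y \<noteq> z"
    by (rule two_paths_of_cyl_diam_pos)
  have R1: "1 < R k"
    unfolding R_def by (rule rho_prod_gt_1[OF k fin v(1) pos vmin eig yz])
  have rho0: "0 < rho \<Lambda> i" if "i \<in> {1..k}" for i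
    by (rule rho_pos_of_inf_path[OF yz(1) fin that pos eig[OF that]])
  have R0: "0 < R n" for n
    unfolding R_def rho_prod_def using rho0 level_color_range[OF k] by (intro prod_pos) auto
  have Rqk: "R (q * k + n) = R k ^ q * R n" for q n
    unfolding R_def by (rule rho_prod_add_mult)
  \<comment> \<open>The exponent of \<open>R n\<close> in the total over length \<open>n\<close>:
    \<open>- s / \<delta>\<close> comes from the weights and 1 from the eigenvector sum. It is
    negative exactly when \<open>s > \<delta>\<close>.\<close>
  define e where "e = 1 - s / \<delta>"
  obtain c C where c: "0 < c" "\<And>v. v \<in> verts \<Lambda> \<Longrightarrow> c * x v \<le> x v powr s"
    and C: "0 < C" "\<And>v. v \<in> verts \<Lambda> \<Longrightarrow> x v powr s \<le> C * x v"
    using powr_comparable_on_finite[of "verts \<Lambda>" x s, OF fin ne pos] by metis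
  have srcV: "snd (path_src \<eta>) \<in> verts \<Lambda>" if "\<eta> \<in> L n" for \<eta> n
    using that path_src_paths_from(2)[of \<eta> k \<Lambda>] fin_paths_eq_UN_paths_from[of k \<Lambda> n]
    unfolding L_def by blast
  have fL: "f \<eta> = R n powr (- s / \<delta>) * x (snd (path_src \<eta>)) powr s" if "\<eta> \<in> L n" for \<eta> n
  proof -
    have "f \<eta> = (R n powr (- 1 / \<delta>) * x (snd (path_src \<eta>))) powr s"
      using that by (simp add: f_def weight_eq[OF k] R_def x_def L_def)
    then show ?thesis
      using R0[of n] pos[OF srcV[OF that]] by (simp add: powr_mult powr_powr)
  qed
  have powR: "R n powr (- s / \<delta>) * R n = R n powr e" for n
    using R0[of n] powr_mult_base[of "R n" "- s / \<delta>"] by (simp add: e_def mult.commute)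
  have sumL: "(\<Sum>\<eta>\<in>L n. R n powr (- s / \<delta>) * (a * x (snd (path_src \<eta>)))) = a * R n powr e" for a n
  proof -
    have "(\<Sum>\<eta>\<in>L n. x (snd (path_src \<eta>))) = R n"
      using sum_fin_paths_len_eigenvector[OF k fin eig, of n] sum1 by (simp add: L_def R_def)
    then have "(\<Sum>\<eta>\<in>L n. R n powr (- s / \<delta>) * (a * x (snd (path_src \<eta>)))) =
        a * (R n powr (- s / \<delta>) * R n)"
      by (simp add: mult.left_commute flip: sum_distrib_left)
    then show ?thesis by (simp only: powR)
  qed
  have upper: "sum f (L n) \<le> C * R n powr e" for n
    unfolding sumL[symmetric] using C srcV by (intro sum_mono) (auto simp: fL intro!: mult_left_mono)
  have lower: "c * R n powr e \<le> sum f (L n)" for n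
    unfolding sumL[symmetric] using c srcV by (intro sum_mono) (auto simp: fL intro!: mult_left_mono)
  have zeta: "zeta k \<Lambda> \<delta> s = (\<Sum>\<^sub>\<infinity>\<eta>\<in>fin_paths k \<Lambda>. ennreal (f \<eta>))"
    by (simp add: zeta_def f_def)
  have f0: "0 \<le> f \<eta>" for \<eta> by (simp add: f_def)
  show ?thesis
  proof
    assume s: "s > \<delta>"
    define a where "a = R k powr e"
    have "e < 0" using s \<delta> by (simp add: e_def)
    then have a: "0 < a" "a < 1"
      using R1 by (auto simp: a_def powr_less_one)
    \<comment> \<open>The bound for the first \<open>k\<close> lengths, one full period; by
      \<open>split\<close> below, the bound for the period starting at \<open>q * k\<close> is
      \<open>a ^ q * D\<close>.\<close>
    define D where "D = (\<Sum>t<k. C * R t powr e)"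
    have D: "0 \<le> D" unfolding D_def using C by (intro sum_nonneg) simp
    have split: "C * R (q * k + t) powr e = a ^ q * (C * R t powr e)" for q t
    proof -
      have "a ^ q = a powr real q" using a by (simp add: powr_realpow)
      also have "\<dots> = (R k powr real q) powr e" by (simp add: a_def powr_powr mult.commute)
      also have "R k powr real q = R k ^ q" using R1 by (simp add: powr_realpow)
      finally have "a ^ q = (R k ^ q) powr e" .
      then show ?thesis
        unfolding Rqk using R1 R0[of t] by (simp add: powr_mult)
    qed
    have "sum f F \<le> D / (1 - a)" if F: "finite F" "F \<subseteq> fin_paths k \<Lambda>" for F
    proof -
      \<comment> \<open>Chosen so that every length occurring in \<open>F\<close> is below
        \<open>N * k\<close>, a whole number of periods; inserting 0 covers the empty
        \<open>F\<close>.\<close>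
      define N where "N = Suc (Max (insert 0 (path_len ` F)))"
      have lenN: "path_len \<eta> < N * k" if "\<eta> \<in> F" for \<eta>
      proof -
        have "path_len \<eta> < N" unfolding N_def using F that by (simp add: less_Suc_eq_le)
        also have "N \<le> N * k" using k by simp
        finally show ?thesis .
      qed
      have "sum f F \<le> (\<Sum>m<N * k. sum f (L m))"
        unfolding L_def by (rule sum_le_sum_by_length[OF fin f0 F lenN])
      also have "\<dots> \<le> (\<Sum>m<N * k. C * R m powr e)"
        by (intro sum_mono upper)
      also have "\<dots> = (\<Sum>q<N. \<Sum>t<k. C * R (q * k + t) powr e)"
        by (subst sum.nat_group[symmetric]) (simp add: sum.atLeastLessThan_shift_0 atLeast0LessThan add.commute)
      also have "\<dots> = (\<Sum>q<N. a ^ q) * D"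
        unfolding split D_def sum_distrib_right by (simp add: sum_distrib_left)
      also have "(\<Sum>q<N. a ^ q) \<le> 1 / (1 - a)"
        using a sum_gp_strict[of a N] by (simp add: divide_right_mono)
      finally show ?thesis using D by (simp add: mult_right_mono)
    qed
    then show "zeta k \<Lambda> \<delta> s < \<infinity>"
      unfolding zeta by (intro infsum_ennreal_finite_of_bounded f0)
  next
    assume fin_zeta: "zeta k \<Lambda> \<delta> s < \<infinity>"
    show "s > \<delta>"
    proof (rule ccontr)
      assume "\<not> s > \<delta>"
      then have e: "0 \<le> e" using \<delta> by (simp add: e_def)
      \<comment> \<open>At a multiple of \<open>k\<close>, \<open>R\<close> is a power of
        \<open>R k\<close> and hence at least 1; as \<open>e\<close> is nonnegative, each of these
        infinitely many lengths contributes at least \<open>c\<close>.\<close>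
      have ge: "c \<le> sum f (L (q * k))" for q
      proof -
        have "1 \<le> R (q * k)" using Rqk[of q 0] R1 by (simp add: R_def rho_prod_def)
        then have "c * 1 \<le> c * R (q * k) powr e"
          using e c(1) by (intro mult_left_mono ge_one_powr_ge_zero) auto
        then show ?thesis using lower[of "q * k"] by simp
      qed
      have "\<exists>F. finite F \<and> F \<subseteq> fin_paths k \<Lambda> \<and> M < sum f F" for M
      proof -
        obtain N :: nat where N: "M < real N * c"
          using reals_Archimedean3[OF c(1)] by blast
        let ?F = "\<Union>q<N. L (q * k)"
        have finL: "finite (L n)" for n unfolding L_def by (rule finite_fin_paths_len[OF fin])
        have "real N * c = (\<Sum>q<N. c)" by simp
        also have "\<dots> \<le> (\<Sum>q<N. sum f (L (q * k)))" by (intro sum_mono ge)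
        \<comment> \<open>The sets are disjoint because \<open>k \<ge> 1\<close> makes the lengths
          \<open>q * k\<close> distinct.\<close>
        also have "\<dots> = sum f ?F"
          using finL k by (intro sum.UNION_disjoint[symmetric]) (auto simp: L_def)
        finally have "M < sum f ?F" using N by simp
        moreover have "finite ?F" "?F \<subseteq> fin_paths k \<Lambda>" using finL by (auto simp: L_def)
        ultimately show ?thesis by blast
      qed
      then have "zeta k \<Lambda> \<delta> s = \<infinity>"
        unfolding zeta by (intro infsum_ennreal_infinite_of_unbounded f0)
      then show False using fin_zeta by simp
    qed
  qed
qed

end
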